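(* Let $H$ be an oriented graph with $h:=v(H)$ and $e(H)\geq 2$, and let $a\in\mathbb{R}$ with $a\geq 1$. For every $\varepsilon>0$ there exists $c>0$ such that for all sufficiently large $N$ there exists a collection $\mathcal{C}$ of digraphs on vertex set $[N]$ with the following properties. (a) For every $H$-free digraph $I$ on $[N]$ there exists $G\in\mathcal{C}$ such that $I\subseteq G$ (in the labelled sense, i.e. $E(I)\subseteq E(G)$). (b) Every digraph $G\in\mathcal{C}$ contains at most $\varepsilon N^h$ copies of $H$, and $e_a(G)\leq \mathrm{ex}_a(N,H)+\varepsilon N^2$. (c) $\log|\mathcal{C}|\leq cN^{2-1/m(H)}\log N$.
   Context: A digraph is a pair $(V,E)$ with $E$ a set of ordered pairs of distinct vertices (no loops; edges in both directions between a pair allowed); an oriented graph has at most one edge between any two vertices. For a digraph $G$, $f_1(G)$ is the number of unordered pairs $\{u,v\}$ with exactly one of $uv,vu$ in $E(G)$, $f_2(G)$ is the number of pairs with both $uv,vu\in E(G)$, and for $a\geq 1$ the weighted size is $e_a(G):=a f_2(G)+f_1(G)$. For a digraph $H$, $\mathrm{ex}_a(n,H)$ is the maximum of $e_a(G)$ over all $H$-free digraphs $G$ on $n$ vertices. For an oriented graph $H$ with $e(H)\geq 2$, $m(H):=\max_{H'\subseteq H,\ e(H')>1}\frac{e(H')-1}{v(H')-2}$. $\log$ is $\log_2$. *)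

theory Defs
  imports Complex_Main "Graph_Theory.Digraph_Isomorphism"
begin

text \<open>
  Digraphs are rendered by the locale \<^locale>\<open>pair_digraph\<close>: finite, loop-free, arcs are ordered
  pairs of vertices (so no parallel arcs, but both directions between two vertices are possible).
\<close>

locale oriented_graph = pair_digraph +
  assumes no_opposite_arcs: "(u, v) \<in> parcs G \<Longrightarrow> (v, u) \<notin> parcs G"

definition digraphs_on :: "'a set \<Rightarrow> 'a pair_pre_digraph set" where
  "digraphs_on V = {G. pair_digraph G \<and> pverts G = V}"

text \<open>
  A copy of \<open>H\<close> in \<open>G\<close> is a (not necessarily induced) subgraph of \<open>G\<close> isomorphic to \<open>H\<close>, so
  copies are counted unlabelled.
\<close>

definition copies :: "'a pair_pre_digraph \<Rightarrow> 'b pair_pre_digraph \<Rightarrow> 'b pair_pre_digraph set" where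
  "copies H G = {K. subgraph (with_proj K) (with_proj G) \<and> digraph_iso (with_proj H) (with_proj K)}"

definition H_free :: "'a pair_pre_digraph \<Rightarrow> 'b pair_pre_digraph \<Rightarrow> bool" where
  "H_free H G \<longleftrightarrow> copies H G = {}"

definition f1 :: "'a pair_pre_digraph \<Rightarrow> nat" where
  "f1 G = card {{u, v} |u v. (u, v) \<in> parcs G \<and> (v, u) \<notin> parcs G}"

definition f2 :: "'a pair_pre_digraph \<Rightarrow> nat" where
  "f2 G = card {{u, v} |u v. (u, v) \<in> parcs G \<and> (v, u) \<in> parcs G}"

definition weighted_size :: "real \<Rightarrow> 'a pair_pre_digraph \<Rightarrow> real" where
  "weighted_size a G = a * real (f2 G) + real (f1 G)"

text \<open>
  Since every finite digraph is isomorphic to one with natural numbers as vertices, it suffices to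
  let \<open>G\<close> range over the latter. The set of values is finite as \<open>f1 G\<close> and \<open>f2 G\<close> are bounded in
  terms of \<open>n\<close>; it is nonempty if \<open>H\<close> has an arc.
\<close>

definition ex_weighted :: "real \<Rightarrow> nat \<Rightarrow> 'a pair_pre_digraph \<Rightarrow> real" where
  "ex_weighted a n H = Max {weighted_size a G |G :: nat pair_pre_digraph.
     pair_digraph G \<and> card (pverts G) = n \<and> H_free H G}"

text \<open>
  An oriented graph with at least two arcs has at least three vertices, so for oriented \<open>H\<close> all
  denominators are positive.
\<close>

definition m_density :: "'a pair_pre_digraph \<Rightarrow> real" where
  "m_density H = Max {(real (card (parcs K)) - 1) / (real (card (pverts K)) - 2) |K.
     subgraph (with_proj K) (with_proj H) \<and> card (parcs K) > 1}"

end

theory Submission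
  imports Defs "HOL-Library.FuncSet"
begin

text \<open>
  Regard the copies of \<open>H\<close> in a digraph \<open>G\<close> on \<open>[N]\<close> as the edges of an \<open>e(H)\<close>-uniform hypergraph on
  the arcs of \<open>G\<close>. With \<open>\<tau> = N powr (- 1 / m(H))\<close>, a set of \<open>j\<close> arcs lies in
  \<open>O(\<tau> ^ (j - 1) * N ^ (h - 2))\<close> copies; this is exactly what the definition of \<open>m(H)\<close> encodes. If
  \<open>G\<close> has at least \<open>\<eta> * N ^ h\<close> copies, the hypergraph container theorem replaces it by
  \<open>exp (O(N powr (2 - 1 / m(H)) * log N))\<close> digraphs with a constant factor fewer arcs that still cover
  all \<open>H\<close>-free subgraphs. Boundedly many rounds starting from the complete digraph leave only digraphs with
  few copies of \<open>H\<close>, and averaging the weighted size over vertex subsets of a fixed size shows that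
  those have weighted size at most \<open>ex_a(N, H) + \<epsilon> * N\<^sup>2\<close>.

  Containers are built by induction on the uniformity: as long as an independent set \<open>I\<close> contains a
  vertex of large degree, its link is added to a hypergraph of uniformity one less, for which \<open>I\<close> is
  again independent. Since the chosen vertices are counted as sequences, at the price of the factor
  \<open>log N\<close>, no canonical order of the vertices is needed, and vertices may be chosen repeatedly.
\<close>

section \<open>Hypergraph containers\<close>

definition codegree :: "'v set \<Rightarrow> ('v set \<Rightarrow> real) \<Rightarrow> 'v set \<Rightarrow> real" where
  "codegree V w T = (\<Sum>E | E \<subseteq> V \<and> T \<subseteq> E. w E)"

text \<open>Edges carry real weights because the hypergraph of lower uniformity built later is a sum
  of links, in which the same set may occur several times.\<close>

definition uniform_weight :: "'v set \<Rightarrow> nat \<Rightarrow> ('v set \<Rightarrow> real) \<Rightarrow> bool" where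
  "uniform_weight V r w \<longleftrightarrow> (\<forall>E. 0 \<le> w E \<and> (w E \<noteq> 0 \<longrightarrow> E \<subseteq> V \<and> card E = r))"

definition independent_for :: "('v set \<Rightarrow> real) \<Rightarrow> 'v set \<Rightarrow> bool" where
  "independent_for w I \<longleftrightarrow> (\<forall>E\<subseteq>I. w E = 0)"

text \<open>The usual codegree hypothesis of container theorems: \<open>D\<close> is the scale of
  the vertex degrees, and each further vertex of \<open>T\<close> costs a factor
  \<open>\<tau>\<close>. Passing to links lowers the uniformity by one and replaces \<open>D\<close>
  by \<open>\<tau> * D\<close>.\<close>

definition codegrees_bounded :: "'v set \<Rightarrow> ('v set \<Rightarrow> real) \<Rightarrow> real \<Rightarrow> real \<Rightarrow> real \<Rightarrow> bool" where
  "codegrees_bounded V w K \<tau> D \<longleftrightarrow>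
     (\<forall>T\<subseteq>V. T \<noteq> {} \<longrightarrow> codegree V w T \<le> K * \<tau> ^ (card T - 1) * D)"

lemma codegree_mono:
  assumes "\<And>E. u E \<le> w E"
  shows "codegree V u T \<le> codegree V w T"
  unfolding codegree_def by (intro sum_mono assms)

text \<open>Double counting of the pairs \<open>T \<subseteq> E\<close>; the later bounds on sums of
  codegrees are read off from it.\<close>

lemma sum_codegree:
  assumes "finite V" "\<T> \<subseteq> Pow V"
  shows "(\<Sum>T\<in>\<T>. codegree V w T) = (\<Sum>E\<in>Pow V. w E * real (card {T\<in>\<T>. T \<subseteq> E}))"
proof -
  have fin: "finite \<T>" using assms finite_subset by auto
  have "(\<Sum>T\<in>\<T>. codegree V w T) = (\<Sum>T\<in>\<T>. \<Sum>E\<in>{E\<in>Pow V. T \<subseteq> E}. w E)"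
    unfolding codegree_def by (intro sum.cong) auto
  also have "\<dots> = (\<Sum>E\<in>Pow V. \<Sum>T\<in>{T\<in>\<T>. T \<subseteq> E}. w E)"
    using assms fin by (intro sum.swap_restrict) auto
  finally show ?thesis by (simp add: mult.commute)
qed

lemma codegree_empty: "codegree V w {} = sum w (Pow V)"
  unfolding codegree_def by (intro sum.cong) auto

lemma sum_codegree_singletons:
  assumes "finite V" "uniform_weight V r w"
  shows "(\<Sum>v\<in>V. codegree V w {v}) = real r * codegree V w {}"
proof -
  have "(\<Sum>v\<in>V. codegree V w {v}) = (\<Sum>T\<in>(\<lambda>v. {v}) ` V. codegree V w T)"
    by (subst sum.reindex) (auto simp: inj_on_def)
  also have "\<dots> = (\<Sum>E\<in>Pow V. w E * real (card {T\<in>(\<lambda>v. {v}) ` V. T \<subseteq> E}))"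
    by (intro sum_codegree assms) auto
  also have "\<dots> = (\<Sum>E\<in>Pow V. real r * w E)"
  proof (intro sum.cong refl)
    fix E assume "E \<in> Pow V"
    then have "{T\<in>(\<lambda>v. {v}) ` V. T \<subseteq> E} = (\<lambda>v. {v}) ` E" by auto
    then have "card {T\<in>(\<lambda>v. {v}) ` V. T \<subseteq> E} = card E"
      by (simp add: card_image)
    then show "w E * real (card {T\<in>(\<lambda>v. {v}) ` V. T \<subseteq> E}) = real r * w E"
      using assms(2) unfolding uniform_weight_def by (cases "w E = 0") auto
  qed
  finally show ?thesis by (simp add: codegree_empty sum_distrib_left)
qed

text \<open>An edge of size \<open>r\<close> contains at most \<open>2 ^ r\<close> members of any
  family.\<close>

lemma sum_codegree_le:
  assumes "finite V" "uniform_weight V r w" "\<T> \<subseteq> Pow V"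
  shows "(\<Sum>T\<in>\<T>. codegree V w T) \<le> 2 ^ r * codegree V w {}"
proof -
  have "(\<Sum>T\<in>\<T>. codegree V w T) \<le> (\<Sum>E\<in>Pow V. 2 ^ r * w E)"
    unfolding sum_codegree[OF assms(1,3)]
  proof (intro sum_mono)
    fix E assume "E \<in> Pow V"
    then have finE: "finite E" using assms(1) finite_subset by auto
    have "card {T\<in>\<T>. T \<subseteq> E} \<le> card (Pow E)" using finE by (intro card_mono) auto
    then have "real (card {T\<in>\<T>. T \<subseteq> E}) \<le> real (2 ^ card E)"
      unfolding of_nat_le_iff by (simp add: card_Pow[OF finE])
    then have *: "real (card {T\<in>\<T>. T \<subseteq> E}) \<le> 2 ^ card E" by simp
    show "w E * real (card {T\<in>\<T>. T \<subseteq> E}) \<le> 2 ^ r * w E"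
    proof (cases "w E = 0")
      case False
      then have "card E = r" "0 \<le> w E" using assms(2) unfolding uniform_weight_def by auto
      then show ?thesis using mult_left_mono[OF *, of "w E"] by (simp add: mult.commute)
    qed simp
  qed
  then show ?thesis by (simp add: codegree_empty sum_distrib_left)
qed

text \<open>Weight of \<open>w\<close> above a saturated set is no longer moved into \<open>g\<close>; since one link adds at most
  \<open>K * \<tau> ^ card T * D\<close> to the codegree of \<open>T\<close>, this keeps the codegrees of \<open>g\<close> within twice that.\<close>

definition saturated :: "'v set \<Rightarrow> ('v set \<Rightarrow> real) \<Rightarrow> real \<Rightarrow> real \<Rightarrow> real \<Rightarrow> 'v set \<Rightarrow> bool" where
  "saturated V g K \<tau> D T \<longleftrightarrow> T \<noteq> {} \<and> K * \<tau> ^ card T * D \<le> codegree V g T"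

definition prune :: "('v set \<Rightarrow> bool) \<Rightarrow> ('v set \<Rightarrow> real) \<Rightarrow> 'v set \<Rightarrow> real" where
  "prune P w E = (if \<exists>T\<subseteq>E. P T then 0 else w E)"

definition link :: "'v \<Rightarrow> ('v set \<Rightarrow> real) \<Rightarrow> 'v set \<Rightarrow> real" where
  "link v w E = (if v \<in> E then 0 else w (insert v E))"

lemma prune_le: "uniform_weight V r w \<Longrightarrow> prune P w E \<le> w E"
  unfolding prune_def uniform_weight_def by auto

lemma uniform_weight_prune: "uniform_weight V r w \<Longrightarrow> uniform_weight V r (prune P w)"
  unfolding prune_def uniform_weight_def by auto

lemma uniform_weight_link:
  assumes "finite V" "uniform_weight V (Suc r) w"
  shows "uniform_weight V r (link v w)"
proof -
  have "E \<subseteq> V \<and> card E = r" if "v \<notin> E" "w (insert v E) \<noteq> 0" for E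
  proof -
    have *: "insert v E \<subseteq> V" "card (insert v E) = Suc r"
      using assms(2) that unfolding uniform_weight_def by blast+
    then have "E \<subseteq> V" by simp
    moreover have "finite E" using \<open>E \<subseteq> V\<close> assms(1) by (rule finite_subset)
    ultimately show ?thesis using *(2) that(1) by simp
  qed
  then show ?thesis using assms(2) unfolding link_def uniform_weight_def by auto
qed

text \<open>Adding \<open>v\<close> is a bijection from the sets avoiding \<open>v\<close> to the
  sets containing it. The guard in \<open>link\<close> ensures that every edge through
  \<open>v\<close> is counted once.\<close>

lemma codegree_link:
  assumes "finite V" "v \<in> V" 
  shows "codegree V (link v w) T = (if v \<in> T then 0 else codegree V w (insert v T))"
proof (cases "v \<in> T")
  case True
  then show ?thesis unfolding codegree_def by (auto simp: link_def intro!: sum.neutral)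
next
  case False
  have "(\<Sum>E | E \<subseteq> V \<and> T \<subseteq> E. link v w E) = (\<Sum>E | E \<subseteq> V \<and> T \<subseteq> E \<and> v \<notin> E. w (insert v E))"
    using assms by (intro sum.mono_neutral_cong_right) (auto simp: link_def)
  also have "\<dots> = (\<Sum>E | E \<subseteq> V \<and> insert v T \<subseteq> E. w E)"
    by (rule sum.reindex_bij_witness[where i = "\<lambda>E. E - {v}" and j = "insert v"])
       (use assms False in \<open>auto simp: insert_absorb\<close>)
  finally show ?thesis using False by (simp add: codegree_def)
qed


section \<open>Container families, the branching step and the induction on the uniformity\<close>

definition covers :: "'v set \<Rightarrow> real \<Rightarrow> 'v set set \<Rightarrow> ('v set \<Rightarrow> bool) \<Rightarrow> bool" where
  "covers V \<delta> F P \<longleftrightarrow> finite F \<and> (\<forall>X\<in>F. X \<subseteq> V \<and> real (card X) \<le> (1 - \<delta>) * real (card V)) \<and>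
     (\<forall>I\<subseteq>V. P I \<longrightarrow> (\<exists>X\<in>F. I \<subseteq> X))"

text \<open>Double counting: a saturated set has large codegree in \<open>g\<close>, so there are few of them, and
  each carries little weight of \<open>w\<close>.\<close>

lemma pruned_weight_ge:
  assumes V: "finite V" and w: "uniform_weight V (Suc r) w" and g: "uniform_weight V r g"
    and bw: "codegrees_bounded V w K \<tau> D" and pos: "K > 0" "\<tau> > 0" "D > 0"
  shows "codegree V w {} - 2 ^ r * codegree V g {} / \<tau> \<le> codegree V (prune (saturated V g K \<tau> D) w) {}"
proof -
  define \<T> where "\<T> = {T\<in>Pow V. saturated V g K \<tau> D T}"
  have \<T>: "\<T> \<subseteq> Pow V" "finite \<T>" using V by (auto simp: \<T>_def)
  let ?w = "prune (saturated V g K \<tau> D) w"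
  \<comment> \<open>Pruning removes the weight of \<open>E\<close> exactly when some member of
    \<open>\<T>\<close> lies in \<open>E\<close>, and then the count on the right is at least
    1.\<close>
  have "w E - ?w E \<le> w E * real (card {T\<in>\<T>. T \<subseteq> E})" if "E \<in> Pow V" for E
  proof (cases "\<exists>T\<subseteq>E. saturated V g K \<tau> D T")
    case True
    then have "{T\<in>\<T>. T \<subseteq> E} \<noteq> {}" using that by (auto simp: \<T>_def)
    then have "card {T\<in>\<T>. T \<subseteq> E} \<ge> 1" using \<T>(2) by (simp add: Suc_le_eq card_gt_0_iff)
    then have "1 \<le> real (card {T\<in>\<T>. T \<subseteq> E})" by simp
    moreover have "0 \<le> w E" using w by (simp add: uniform_weight_def)
    ultimately have "w E * 1 \<le> w E * real (card {T\<in>\<T>. T \<subseteq> E})" by (rule mult_left_mono)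
    then show ?thesis using True by (auto simp: prune_def)
  next
    case False
    then have "?w E = w E" unfolding prune_def by (intro if_not_P) blast
    then show ?thesis using w by (simp add: uniform_weight_def)
  qed
  then have "(\<Sum>E\<in>Pow V. w E - ?w E) \<le> (\<Sum>T\<in>\<T>. codegree V w T)"
    unfolding sum_codegree[OF V \<T>(1)] by (rule sum_mono)
  also have "\<dots> \<le> (\<Sum>T\<in>\<T>. codegree V g T / \<tau>)"
  proof (rule sum_mono)
    fix T assume T: "T \<in> \<T>"
    then have ne: "T \<noteq> {}" "T \<subseteq> V" and sat: "K * \<tau> ^ card T * D \<le> codegree V g T"
      by (auto simp: \<T>_def saturated_def)
    \<comment> \<open>The saturation threshold has one factor \<open>\<tau>\<close> more than the
      bound on the codegree of \<open>T\<close> in \<open>w\<close>; this factor becomes the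
      division by \<open>\<tau>\<close>. Since \<open>T\<close> is nonempty,
      \<open>card T - 1\<close> is not truncated.\<close>
    have "card T \<noteq> 0" using ne V by (auto dest: finite_subset)
    then have "\<tau> ^ card T = \<tau> ^ (card T - 1) * \<tau>" by (cases "card T") auto
    then have "K * \<tau> ^ (card T - 1) * D \<le> codegree V g T / \<tau>"
      using sat pos by (simp add: pos_le_divide_eq algebra_simps)
    moreover have "codegree V w T \<le> K * \<tau> ^ (card T - 1) * D"
      using bw ne by (simp add: codegrees_bounded_def)
    ultimately show "codegree V w T \<le> codegree V g T / \<tau>" by linarith
  qed
  also have "\<dots> \<le> 2 ^ r * codegree V g {} / \<tau>"
    unfolding sum_divide_distrib[symmetric]
    using sum_codegree_le[OF V g \<T>(1)] pos by (intro divide_right_mono) auto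
  finally show ?thesis by (simp add: codegree_empty sum_subtractf)
qed

text \<open>If \<open>T\<close> contains \<open>v\<close> or is saturated, the pruned link adds
  nothing above \<open>T\<close>. Otherwise the old codegree is below
  \<open>K * \<tau> ^ card T * D\<close>, and the link adds at most the codegree of
  \<open>insert v T\<close> in \<open>w\<close>, which obeys the same bound. Hence the factor 2, and
  no dependence on the number of links added so far.\<close>

lemma codegrees_bounded_add_link:
  assumes V: "finite V" and v: "v \<in> V" and w: "uniform_weight V (Suc r) w"
    and bw: "codegrees_bounded V w K \<tau> D" and bg: "codegrees_bounded V g (2 * K) \<tau> (\<tau> * D)"
    and pos: "K > 0" "\<tau> > 0" "D > 0"
  shows "codegrees_bounded V (\<lambda>E. g E + link v (prune (saturated V g K \<tau> D) w) E) (2 * K) \<tau> (\<tau> * D)"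
  unfolding codegrees_bounded_def
proof (intro allI impI)
  fix T assume T: "T \<subseteq> V" "T \<noteq> {}"
  let ?w = "prune (saturated V g K \<tau> D) w"
  have sum: "codegree V (\<lambda>E. g E + link v ?w E) T = codegree V g T + codegree V (link v ?w) T"
    by (simp add: codegree_def sum.distrib)
  have finT: "finite T" using T(1) V by (rule finite_subset)
  then have "card T \<noteq> 0" using T by simp
  then have pow: "\<tau> ^ (card T - 1) * (\<tau> * D) = \<tau> ^ card T * D" by (cases "card T") auto
  show "codegree V (\<lambda>E. g E + link v ?w E) T \<le> 2 * K * \<tau> ^ (card T - 1) * (\<tau> * D)"
  proof (cases "v \<in> T \<or> saturated V g K \<tau> D T")
    case True
    have "codegree V (link v ?w) T = 0"
    proof (cases "v \<in> T")
      case False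
      then have "saturated V g K \<tau> D T" using True by simp
      then have "?w E = 0" if "insert v T \<subseteq> E" for E using that unfolding prune_def by auto
      then show ?thesis using False by (simp add: codegree_link[OF V v]) (simp add: codegree_def)
    qed (simp add: codegree_link[OF V v])
    then show ?thesis using bg T unfolding sum codegrees_bounded_def by simp
  next
    case False
    then have "codegree V g T \<le> K * \<tau> ^ card T * D" using T by (auto simp: saturated_def)
    moreover have "codegree V (link v ?w) T \<le> codegree V w (insert v T)"
      using False codegree_mono[of ?w w, OF prune_le[OF w]] by (simp add: codegree_link[OF V v])
    moreover have "codegree V w (insert v T) \<le> K * \<tau> ^ (card (insert v T) - 1) * D"
      using bw T(1) v by (simp add: codegrees_bounded_def)
    ultimately have "codegree V (\<lambda>E. g E + link v ?w E) T \<le> 2 * (K * (\<tau> ^ card T * D))"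
      using False finT unfolding sum by simp
    then show ?thesis unfolding mult.assoc pow .
  qed
qed

text \<open>The degrees sum to at least the total weight, hence to at least
  \<open>3 / 4 * \<kappa> * card V * D\<close>. The low vertices account for at most
  \<open>\<kappa> / 4 * card V * D\<close> of this, so \<open>\<kappa> / 2 * card V * D\<close> must
  come from the others, each of degree at most \<open>K * D\<close>. Thus at least a proportion
  \<open>\<kappa> / (2 * K)\<close> of the vertices is not low.\<close>

lemma low_degree_vertices_card_le:
  assumes V: "finite V" and u: "uniform_weight V (Suc r) u"
    and bu: "\<And>v. v \<in> V \<Longrightarrow> codegree V u {v} \<le> K * D"
    and e: "3 / 4 * \<kappa> * real (card V) * D \<le> codegree V u {}" and pos: "K > 0" "D > 0" "\<kappa> > 0"
  shows "real (card {v\<in>V. codegree V u {v} < \<kappa> / 4 * D}) \<le> (1 - \<kappa> / (2 * K)) * real (card V)"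
proof -
  let ?L = "{v\<in>V. codegree V u {v} < \<kappa> / 4 * D}"
  let ?n = "real (card V)"
  have e0: "0 \<le> codegree V u {}"
    using u by (auto simp: codegree_def uniform_weight_def intro!: sum_nonneg)
  have "3 / 4 * \<kappa> * ?n * D \<le> 1 * codegree V u {}" using e by simp
  also have "\<dots> \<le> real (Suc r) * codegree V u {}" using e0 by (intro mult_right_mono) auto
  also have "\<dots> = (\<Sum>v\<in>V. codegree V u {v})" using sum_codegree_singletons[OF V u] by simp
  also have "\<dots> = (\<Sum>v\<in>?L. codegree V u {v}) + (\<Sum>v\<in>V - ?L. codegree V u {v})"
    using V by (subst add.commute, intro sum.subset_diff) auto
  also have "\<dots> \<le> real (card ?L) * (\<kappa> / 4 * D) + real (card (V - ?L)) * (K * D)"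
    using bu by (intro add_mono sum_bounded_above) auto
  also have "\<dots> \<le> ?n * (\<kappa> / 4 * D) + real (card (V - ?L)) * (K * D)"
    using V pos by (intro add_right_mono mult_right_mono) (auto intro: card_mono)
  also have "card (V - ?L) = card V - card ?L" using V by (intro card_Diff_subset) auto
  also have "real (card V - card ?L) = ?n - real (card ?L)"
    using V by (intro of_nat_diff card_mono) auto
  finally have "(?n * \<kappa> / 2) * D \<le> ((?n - real (card ?L)) * K) * D" by (simp add: algebra_simps)
  then have "?n * \<kappa> / 2 \<le> (?n - real (card ?L)) * K" using pos by simp
  then have "?n * \<kappa> / 2 / K \<le> ?n - real (card ?L)" using pos by (simp add: pos_divide_le_eq)
  then show ?thesis by (simp add: algebra_simps)
qed

text \<open>An edge of the link inside \<open>I\<close> extends by \<open>v\<close> to an edge of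
  \<open>w\<close> inside \<open>I\<close>. This is what allows a descent to lower uniformity
  without losing independent sets.\<close>

lemma independent_for_link:
  assumes "independent_for w I" "v \<in> I" 
  shows "independent_for (link v (prune P w)) I"
  using assms unfolding independent_for_def link_def prune_def by auto

text \<open>Either an independent set contains only vertices of low pruned degree, and these form a
  container, or we branch over one of its vertices \<open>v\<close> of high degree and add the link of \<open>v\<close> to \<open>g\<close>.
  Each branching step increases the total weight of \<open>g\<close> by \<open>\<kappa> / 4 * D\<close>, so \<open>s\<close> bounds the depth.\<close>

lemma container_branching:
  assumes V: "finite V" and w: "uniform_weight V (Suc r) w"
    and bw: "codegrees_bounded V w K \<tau> D" and pos: "K > 0" "\<tau> > 0" "D > 0" "\<kappa> > 0"
    and ew: "\<kappa> * real (card V) * D \<le> codegree V w {}"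
    and \<delta>: "\<delta> \<le> \<kappa> / (2 * K)" and B: "B \<ge> 1"
    and IH: "\<And>g. uniform_weight V r g \<Longrightarrow> codegrees_bounded V g (2 * K) \<tau> (\<tau> * D) \<Longrightarrow>
      \<kappa> / 2 ^ (r + 2) * real (card V) * (\<tau> * D) \<le> codegree V g {} \<Longrightarrow>
      \<exists>F. card F \<le> B \<and> covers V \<delta> F (independent_for g)"
    and g: "uniform_weight V r g" "codegrees_bounded V g (2 * K) \<tau> (\<tau> * D)"
    and s: "\<kappa> / 2 ^ (r + 2) * real (card V) * (\<tau> * D) \<le> codegree V g {} + real s * (\<kappa> / 4 * D)"
  shows "\<exists>F. card F \<le> (card V + 1) ^ s * B \<and>
    covers V \<delta> F (\<lambda>I. independent_for w I \<and> independent_for g I)"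
  using g s
proof (induction s arbitrary: g)
  case 0
  then obtain F where "card F \<le> B" "covers V \<delta> F (independent_for g)" using IH[of g] by auto
  then show ?case by (intro exI[of _ F]) (auto simp: covers_def)
next
  case (Suc s)
  show ?case
  proof (cases "\<kappa> / 2 ^ (r + 2) * real (card V) * (\<tau> * D) \<le> codegree V g {}")
    case True
    \<comment> \<open>A heavy \<open>g\<close> needs no further branching: the containers for
      \<open>g\<close> alone already cover every set independent for both hypergraphs.\<close>
    then obtain F where F: "card F \<le> B" "covers V \<delta> F (independent_for g)" using IH[of g] Suc.prems by auto
    have "card F \<le> 1 * B" using F by simp
    also have "\<dots> \<le> (card V + 1) ^ Suc s * B" by (intro mult_right_mono one_le_power) auto
    finally show ?thesis using F by (intro exI[of _ F]) (auto simp: covers_def)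
  next
    case False
    define u where "u = prune (saturated V g K \<tau> D) w"
    have u: "uniform_weight V (Suc r) u" unfolding u_def by (rule uniform_weight_prune[OF w])
    define L where "L = {v\<in>V. codegree V u {v} < \<kappa> / 4 * D}"
    \<comment> \<open>While \<open>g\<close> is light, pruning costs at most a quarter of the
      guaranteed weight of \<open>w\<close>. The threshold has the denominator
      \<open>2 ^ (r + 2)\<close> so that the factor \<open>2 ^ r\<close> of
      \<open>pruned_weight_ge\<close> leaves exactly \<open>\<kappa> / 4\<close>.\<close>
    have "2 ^ r * codegree V g {} / \<tau> \<le> 2 ^ r * (\<kappa> / 2 ^ (r + 2) * real (card V) * (\<tau> * D)) / \<tau>"
      using False pos by (intro divide_right_mono mult_left_mono) auto
    also have "\<dots> = \<kappa> / 4 * real (card V) * D" using pos by (simp add: field_simps power_add)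
    finally have "3 / 4 * \<kappa> * real (card V) * D \<le> codegree V u {}"
      using pruned_weight_ge[OF V w Suc.prems(1) bw pos(1-3)] ew unfolding u_def by linarith
    moreover have "codegree V u {v} \<le> K * D" if "v \<in> V" for v
    proof -
      have "codegree V u {v} \<le> codegree V w {v}"
        unfolding u_def by (rule codegree_mono) (rule prune_le[OF w])
      also have "\<dots> \<le> K * \<tau> ^ (card {v} - 1) * D"
        using bw that unfolding codegrees_bounded_def by blast
      finally show ?thesis by simp
    qed
    ultimately have "real (card L) \<le> (1 - \<kappa> / (2 * K)) * real (card V)"
      unfolding L_def using low_degree_vertices_card_le[OF V u] pos by blast
    also have "\<dots> \<le> (1 - \<delta>) * real (card V)" using \<delta> by (intro mult_right_mono) auto
    finally have L: "real (card L) \<le> (1 - \<delta>) * real (card V)" .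
    \<comment> \<open>One branch for each vertex outside \<open>L\<close>. Its degree in
      \<open>u\<close> is at least \<open>\<kappa> / 4 * D\<close>, which is the weight gained by
      \<open>g\<close>, so one step fewer suffices afterwards.\<close>
    have "\<forall>v\<in>V - L. \<exists>F. card F \<le> (card V + 1) ^ s * B \<and>
      covers V \<delta> F (\<lambda>I. independent_for w I \<and> independent_for (\<lambda>E. g E + link v u E) I)"
    proof (intro ballI Suc.IH)
      fix v assume v: "v \<in> V - L"
      show "uniform_weight V r (\<lambda>E. g E + link v u E)"
        using uniform_weight_link[OF V u, of v] Suc.prems(1) unfolding uniform_weight_def by (smt (verit))
      show "codegrees_bounded V (\<lambda>E. g E + link v u E) (2 * K) \<tau> (\<tau> * D)"
        unfolding u_def using v by (intro codegrees_bounded_add_link[OF V _ w bw Suc.prems(2)] pos) auto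
      have "codegree V (\<lambda>E. g E + link v u E) {} = codegree V g {} + codegree V (link v u) {}"
        by (simp add: codegree_def sum.distrib)
      moreover have "codegree V (link v u) {} \<ge> \<kappa> / 4 * D"
        using v codegree_link[OF V, of v u "{}"] by (auto simp: L_def)
      ultimately show "\<kappa> / 2 ^ (r + 2) * real (card V) * (\<tau> * D)
        \<le> codegree V (\<lambda>E. g E + link v u E) {} + real s * (\<kappa> / 4 * D)"
        using Suc.prems(3) unfolding of_nat_Suc distrib_right mult_1 by linarith
    qed
    from bchoice[OF this] obtain F where F: "\<And>v. v \<in> V - L \<Longrightarrow> card (F v) \<le> (card V + 1) ^ s * B"
      "\<And>v. v \<in> V - L \<Longrightarrow> covers V \<delta> (F v) (\<lambda>I. independent_for w I \<and> independent_for (\<lambda>E. g E + link v u E) I)"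
      by blast
    \<comment> \<open>\<open>L\<close> handles the independent sets inside \<open>L\<close>; any
      other one meets \<open>V - L\<close> and is covered in the branch of such a vertex. The extra
      container \<open>L\<close> is absorbed by the base \<open>card V + 1\<close>.\<close>
    define F' where "F' = insert L (\<Union>v\<in>V - L. F v)"
    have fin: "finite (V - L)" using V by simp
    have "card F' \<le> Suc (card (\<Union>v\<in>V - L. F v))" unfolding F'_def by (rule card_insert_le_m1) auto
    also have "card (\<Union>v\<in>V - L. F v) \<le> (\<Sum>v\<in>V - L. card (F v))" by (rule card_UN_le[OF fin])
    also have "\<dots> \<le> of_nat (card (V - L)) * ((card V + 1) ^ s * B)" using F(1) by (rule sum_bounded_above)
    also have "\<dots> \<le> card V * ((card V + 1) ^ s * B)" using V by (auto intro!: mult_right_mono card_mono)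
    finally have "card F' \<le> 1 + card V * ((card V + 1) ^ s * B)" by simp
    also have "\<dots> \<le> (card V + 1) ^ s * B + card V * ((card V + 1) ^ s * B)"
      using B by (intro add_right_mono) (simp add: Suc_le_eq)
    also have "\<dots> = (card V + 1) ^ Suc s * B" by (simp add: algebra_simps)
    finally have "card F' \<le> (card V + 1) ^ Suc s * B" .
    moreover have "covers V \<delta> F' (\<lambda>I. independent_for w I \<and> independent_for g I)"
      unfolding covers_def
    proof (intro conjI allI ballI impI)
      show "finite F'" using F(2) fin unfolding F'_def covers_def by auto
      fix X assume X: "X \<in> F'"
      show "X \<subseteq> V" "real (card X) \<le> (1 - \<delta>) * real (card V)"
        using X F(2) L unfolding F'_def covers_def by (auto simp: L_def)
    next
      fix I assume I: "I \<subseteq> V" "independent_for w I \<and> independent_for g I"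
      show "\<exists>X\<in>F'. I \<subseteq> X"
      proof (cases "I \<subseteq> L")
        case False
        then obtain v where v: "v \<in> I" "v \<in> V - L" using I by auto
        have "independent_for (\<lambda>E. g E + link v u E) I"
          using I(2) independent_for_link[of w I v] v(1) unfolding u_def independent_for_def by simp
        then show ?thesis using F(2)[OF v(2)] I v(2) unfolding covers_def F'_def by blast
      qed (auto simp: F'_def)
    qed
    ultimately show ?thesis by blast
  qed
qed

text \<open>The constants depend only on \<open>r\<close>, \<open>K\<close> and
  \<open>\<kappa>\<close>, not on \<open>V\<close>, \<open>w\<close>, \<open>\<tau>\<close> or
  \<open>D\<close>. The number \<open>s\<close> bounds the length of the sequence of chosen
  vertices, which determines the container. In the induction step, branching starts from
  \<open>g = 0\<close> and continues until \<open>g\<close> meets the hypotheses for uniformity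
  \<open>r\<close> at degree scale \<open>\<tau> * D\<close>.\<close>

theorem hypergraph_containers:
  fixes K \<kappa> :: real
  assumes "K > 0" "\<kappa> > 0"
  shows "\<exists>\<delta>>0. \<exists>M::real. M \<ge> 0 \<and> (\<forall>(V::'v set) w \<tau> D. finite V \<longrightarrow> uniform_weight V r w \<longrightarrow> \<tau> > 0 \<longrightarrow> D > 0 \<longrightarrow>
    codegrees_bounded V w K \<tau> D \<longrightarrow> \<kappa> * real (card V) * D \<le> codegree V w {} \<longrightarrow> V \<noteq> {} \<longrightarrow>
    (\<exists>F s. real s \<le> M * (\<tau> * real (card V) + 1) \<and> card F \<le> (card V + 1) ^ s \<and> covers V \<delta> F (independent_for w)))"
  using assms
proof (induction r arbitrary: K \<kappa>)
  case 0
  \<comment> \<open>In uniformity 0 the only possible edge is the empty set. Positive total weight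
    makes it an edge, so no set is independent and the empty family covers.\<close>
  have "covers V 1 {} (independent_for w)"
    if "finite V" "V \<noteq> {}" "D > 0" "uniform_weight V 0 w" "\<kappa> * real (card V) * D \<le> codegree V w {}"
    for V :: "'v set" and w D
  proof -
    have "codegree V w {} > 0" using that 0 by (smt (verit) card_gt_0_iff mult_pos_pos of_nat_0_less_iff)
    then obtain E where E: "E \<subseteq> V" "w E \<noteq> 0"
      unfolding codegree_empty by (metis PowD less_irrefl sum.neutral)
    then have "E = {}" using that(1,4) unfolding uniform_weight_def by (meson card_eq_0_iff finite_subset)
    then have "\<not> independent_for w I" for I using E unfolding independent_for_def by auto
    then show ?thesis by (simp add: covers_def)
  qed
  then show ?case by (intro exI[of _ 1] conjI exI[of _ 0]) (auto intro!: exI[of _ "{}"])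
next
  case (Suc r)
  \<comment> \<open>\<open>K\<close> doubles because of \<open>codegrees_bounded_add_link\<close>;
    the new density is the threshold at which branching stops.\<close>
  have "2 * K > 0" "\<kappa> / 2 ^ (r + 2) > 0" using Suc.prems by auto
  from Suc.IH[OF this] obtain \<delta> M where \<delta>: "\<delta> > 0" and M: "M \<ge> 0" and
    IH: "\<And>(V::'v set) w \<tau> D. finite V \<Longrightarrow> uniform_weight V r w \<Longrightarrow> \<tau> > 0 \<Longrightarrow> D > 0 \<Longrightarrow>
    codegrees_bounded V w (2 * K) \<tau> D \<Longrightarrow> \<kappa> / 2 ^ (r + 2) * real (card V) * D \<le> codegree V w {} \<Longrightarrow> V \<noteq> {} \<Longrightarrow>
    (\<exists>F s. real s \<le> M * (\<tau> * real (card V) + 1) \<and> card F \<le> (card V + 1) ^ s \<and> covers V \<delta> F (independent_for w))"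
    by blast
  \<comment> \<open>A container is either a set \<open>L\<close> of low vertices, missing a
    proportion \<open>\<kappa> / (2 * K)\<close>, or comes from the induction hypothesis, missing
    \<open>\<delta>\<close>.\<close>
  define \<delta>' where "\<delta>' = min \<delta> (\<kappa> / (2 * K))"
  have \<delta>': "\<delta>' > 0" "\<delta>' \<le> \<kappa> / (2 * K)" "\<delta>' \<le> \<delta>" using \<delta> Suc.prems by (auto simp: \<delta>'_def)
  have "\<exists>F s. real s \<le> (M + 1) * (\<tau> * real (card V) + 1) \<and> card F \<le> (card V + 1) ^ s \<and> covers V \<delta>' F (independent_for w)"
    if V: "finite V" "V \<noteq> {}" and w: "uniform_weight V (Suc r) w" and pos: "\<tau> > 0" "D > 0"
      and bw: "codegrees_bounded V w K \<tau> D" and ew: "\<kappa> * real (card V) * D \<le> codegree V w {}"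
    for V :: "'v set" and w \<tau> D
  proof -
    let ?n = "real (card V)"
    \<comment> \<open>\<open>S\<close> is a common bound on the exponents supplied by the induction
      hypothesis for all the different \<open>g\<close>. The depth \<open>s\<close> below suffices:
      each step gains \<open>\<kappa> / 4 * D\<close>, and the target
      \<open>\<kappa> / 2 ^ (r + 2) * card V * (\<tau> * D)\<close> is at most
      \<open>\<tau> * card V\<close> times that.\<close>
    define S where "S = nat \<lfloor>M * (\<tau> * ?n + 1)\<rfloor>"
    have S: "real S \<le> M * (\<tau> * ?n + 1)" using M pos by (simp add: S_def)
    define s where "s = nat \<lceil>\<tau> * ?n\<rceil>"
    have s: "real s \<le> \<tau> * ?n + 1" "\<tau> * ?n \<le> real s" using pos by (auto simp: s_def)
    have "\<exists>F. card F \<le> (card V + 1) ^ s * (card V + 1) ^ S \<and>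
      covers V \<delta>' F (\<lambda>I. independent_for w I \<and> independent_for (\<lambda>E. 0) I)"
    proof (rule container_branching[OF V(1) w bw _ _ _ _ ew \<delta>'(2)])
      fix g assume g: "uniform_weight V r g" "codegrees_bounded V g (2 * K) \<tau> (\<tau> * D)"
        "\<kappa> / 2 ^ (r + 2) * ?n * (\<tau> * D) \<le> codegree V g {}"
      obtain F t where F: "real t \<le> M * (\<tau> * ?n + 1)" "card F \<le> (card V + 1) ^ t"
        "covers V \<delta> F (independent_for g)"
        using IH[OF V(1) g(1) pos(1) _ g(2,3) V(2)] pos by auto
      have "t \<le> S" using F(1) by (simp add: S_def le_nat_iff le_floor_iff)
      then have "card F \<le> (card V + 1) ^ S" using F(2) power_increasing[of t S "card V + 1"] by simp
      moreover have "(1 - \<delta>) * ?n \<le> (1 - \<delta>') * ?n" using \<delta>'(3) by (intro mult_right_mono) auto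
      then have "covers V \<delta>' F (independent_for g)" using F(3) unfolding covers_def by force
      ultimately show "\<exists>F. card F \<le> (card V + 1) ^ S \<and> covers V \<delta>' F (independent_for g)" by blast
    next
      have "\<kappa> / 2 ^ (r + 2) * ?n * (\<tau> * D) = (\<tau> * ?n) * (\<kappa> / 2 ^ (r + 2) * D)" by simp
      also have "\<dots> \<le> real s * (\<kappa> / 4 * D)"
      proof (intro mult_mono s mult_right_mono divide_left_mono)
        have "(2::real) ^ 2 \<le> 2 ^ (r + 2)" by (rule power_increasing) auto
        then show "(4::real) \<le> 2 ^ (r + 2)" by simp
      qed (use pos Suc.prems in auto)
      finally show "\<kappa> / 2 ^ (r + 2) * ?n * (\<tau> * D) \<le> codegree V (\<lambda>E. 0) {} + real s * (\<kappa> / 4 * D)"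
        by (simp add: codegree_def)
    qed (use pos Suc.prems in \<open>auto simp: uniform_weight_def codegrees_bounded_def codegree_def\<close>)
    then obtain F where F: "card F \<le> (card V + 1) ^ (s + S)" "covers V \<delta>' F (independent_for w)"
      by (auto simp: power_add independent_for_def[of "\<lambda>E. 0"])
    moreover have "real (s + S) \<le> (M + 1) * (\<tau> * ?n + 1)" using s S by (simp add: algebra_simps)
    ultimately show ?thesis by blast
  qed
  then show ?case using \<delta>'(1) M by (intro exI[of _ \<delta>'] conjI exI[of _ "M + 1"]) auto
qed

section \<open>Embeddings and weighted sizes\<close>

definition embeddings :: "'a pair_pre_digraph \<Rightarrow> 'b pair_pre_digraph \<Rightarrow> ('a \<Rightarrow> 'b) set" where
  "embeddings H G = {\<phi> \<in> pverts H \<rightarrow>\<^sub>E pverts G.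
     inj_on \<phi> (pverts H) \<and> map_prod \<phi> \<phi> ` parcs H \<subseteq> parcs G}"

lemma wf_digraph_with_proj: "wf_digraph (with_proj G) \<longleftrightarrow> parcs G \<subseteq> pverts G \<times> pverts G"
  unfolding wf_digraph_def by force

lemma pair_digraph_iff:
  "pair_digraph G \<longleftrightarrow> finite (pverts G) \<and> parcs G \<subseteq> pverts G \<times> pverts G \<and> (\<forall>(u, v)\<in>parcs G. u \<noteq> v)"
proof -
  have "finite (parcs G)" if "finite (pverts G)" "parcs G \<subseteq> pverts G \<times> pverts G"
    using that by (meson finite_SigmaI finite_subset)
  then show ?thesis
    unfolding pair_digraph_def pair_fin_digraph_def pair_loopfree_digraph_def pair_wf_digraph_def
      pair_fin_digraph_axioms_def pair_loopfree_digraph_axioms_def by force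
qed

lemma finite_parcs: "pair_digraph G \<Longrightarrow> finite (parcs G)"
  by (simp add: pair_digraph_def pair_fin_digraph_def pair_fin_digraph_axioms_def)

lemma subgraph_with_proj:
  "subgraph (with_proj K) (with_proj G) \<longleftrightarrow> pverts K \<subseteq> pverts G \<and> parcs K \<subseteq> parcs G \<and>
     parcs G \<subseteq> pverts G \<times> pverts G \<and> parcs K \<subseteq> pverts K \<times> pverts K"
  unfolding subgraph_def by (auto simp: wf_digraph_with_proj compatible_def)

lemma finite_embeddings:
  "finite (pverts H) \<Longrightarrow> finite (pverts G) \<Longrightarrow> finite (embeddings H G)"
  unfolding embeddings_def by (intro finite_Collect_conjI disjI1) (simp add: finite_PiE)

text \<open>\<open>with_proj\<close> fixes tail and head as the two projections, so the arc part of
  an isomorphism is forced to be \<open>map_prod\<close> of its vertex part. Restricting the vertex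
  part to \<open>pverts H\<close> makes it extensional.\<close>

lemma copies_eq_image_embeddings:
  assumes H: "pair_digraph H" and G: "pair_digraph G"
  shows "copies H G =
    (\<lambda>\<phi>. \<lparr>pverts = \<phi> ` pverts H, parcs = map_prod \<phi> \<phi> ` parcs H\<rparr>) ` embeddings H G" (is "_ = ?K ` _")
proof (intro equalityI subsetI)
  fix K assume "K \<in> copies H G"
  then have sub: "subgraph (with_proj K) (with_proj G)" and iso: "digraph_iso (with_proj H) (with_proj K)"
    by (auto simp: copies_def)
  from iso obtain f where f: "pre_digraph.digraph_isomorphism (with_proj H) f" "with_proj K = app_iso f (with_proj H)"
    by (auto simp: digraph_iso_def)
  have K: "pverts K = iso_verts f ` pverts H" "parcs K = iso_arcs f ` parcs H"
    "iso_tail f = fst" "iso_head f = snd"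
    using f(2) by (metis app_iso_simps with_proj_simps)+
  define \<phi> where "\<phi> = restrict (iso_verts f) (pverts H)"
  have H': "parcs H \<subseteq> pverts H \<times> pverts H" using H by (simp add: pair_digraph_iff)
  have inj: "inj_on \<phi> (pverts H)"
    using f(1) by (auto simp: pre_digraph.digraph_isomorphism_def \<phi>_def inj_on_def)
  have "iso_arcs f e = map_prod \<phi> \<phi> e" if "e \<in> parcs H" for e
    using f(1) that H' K(3,4) by (auto simp: pre_digraph.digraph_isomorphism_def \<phi>_def prod_eq_iff)
  then have arcs: "parcs K = map_prod \<phi> \<phi> ` parcs H" using K(2) by force
  have verts: "pverts K = \<phi> ` pverts H" using K(1) by (simp add: \<phi>_def)
  have "\<phi> \<in> embeddings H G"
    using sub arcs verts inj by (auto simp: embeddings_def subgraph_with_proj \<phi>_def)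
  moreover have "K = ?K \<phi>" using arcs verts by simp
  ultimately show "K \<in> ?K ` embeddings H G" by blast
next
  fix K assume "K \<in> ?K ` embeddings H G"
  then obtain \<phi> where \<phi>: "\<phi> \<in> embeddings H G" and K: "K = ?K \<phi>" by blast
  have H': "parcs H \<subseteq> pverts H \<times> pverts H" using H by (simp add: pair_digraph_iff)
  have G': "parcs G \<subseteq> pverts G \<times> pverts G" using G by (simp add: pair_digraph_iff)
  have inj: "inj_on \<phi> (pverts H)" using \<phi> by (simp add: embeddings_def)
  have sub: "subgraph (with_proj K) (with_proj G)"
    using \<phi> H' G' by (auto simp: K subgraph_with_proj embeddings_def)
  define f where "f = \<lparr>iso_verts = \<phi>, iso_arcs = map_prod \<phi> \<phi>, iso_head = snd, iso_tail = fst\<rparr>"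
  have "inj_on (map_prod \<phi> \<phi>) (parcs H)"
    using map_prod_inj_on[OF inj inj] H' by (rule inj_on_subset)
  then have "pre_digraph.digraph_isomorphism (with_proj H) f"
    using inj H' by (auto simp: pre_digraph.digraph_isomorphism_def f_def wf_digraph_with_proj)
  moreover have "with_proj K = app_iso f (with_proj H)"
    by (simp add: K f_def app_iso_def with_proj_def)
  ultimately have "digraph_iso (with_proj H) (with_proj K)" unfolding digraph_iso_def by blast
  then show "K \<in> copies H G" using sub by (simp add: copies_def)
qed

lemma card_copies_le:
  assumes "pair_digraph H" "pair_digraph G"
  shows "card (copies H G) \<le> card (embeddings H G)"
  unfolding copies_eq_image_embeddings[OF assms] using assms
  by (intro card_image_le finite_embeddings) (auto simp: pair_digraph_iff)

lemma H_free_iff: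
  assumes "pair_digraph H" "pair_digraph G"
  shows "H_free H G \<longleftrightarrow> embeddings H G = {}"
  unfolding H_free_def copies_eq_image_embeddings[OF assms] by simp

text \<open>A pair joined in both directions is split into two arcs of weight \<open>a / 2\<close>.
  In this form the weight is additive over arcs, and the weight of an arc depends only on whether
  its reverse is present, which suits averaging over induced subdigraphs.\<close>

lemma weighted_size_eq_sum:
  assumes "pair_digraph G"
  shows "weighted_size a G = (\<Sum>(u, v)\<in>parcs G. if (v, u) \<in> parcs G then a / 2 else 1)"
proof -
  let ?A = "parcs G" and ?p = "\<lambda>(u, v). {u, v}"
  define B where "B = {(u, v). (u, v) \<in> ?A \<and> (v, u) \<in> ?A}"
  have fin: "finite ?A" using assms by (auto simp: pair_digraph_iff intro: finite_subset)
  have loop: "u \<noteq> v" if "(u, v) \<in> ?A" for u v using assms that by (auto simp: pair_digraph_iff)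
  have B: "B \<subseteq> ?A" "finite B" using fin by (auto simp: B_def intro: finite_subset)
  have "{{u, v} |u v. (u, v) \<in> ?A \<and> (v, u) \<notin> ?A} = ?p ` (?A - B)" by (auto simp: B_def image_def)
  moreover have "inj_on ?p (?A - B)" by (auto simp: inj_on_def B_def doubleton_eq_iff)
  ultimately have f1: "f1 G = card (?A - B)" by (simp add: f1_def card_image)
  have "{{u, v} |u v. (u, v) \<in> ?A \<and> (v, u) \<in> ?A} = ?p ` B" by (auto simp: B_def image_def)
  then have f2: "f2 G = card (?p ` B)" by (simp add: f2_def)
  \<comment> \<open>\<open>B\<close> consists of the arcs whose reverse is present. As there are no
    loops, every unordered pair arising from \<open>B\<close> comes from exactly two arcs.\<close>
  have "card B = (\<Sum>e\<in>?p ` B. card {x\<in>B. ?p x = e})"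
    using sum.image_gen[OF B(2), of "\<lambda>_. 1::nat" ?p] by simp
  also have "\<dots> = (\<Sum>e\<in>?p ` B. 2)"
  proof (rule sum.cong)
    fix e assume "e \<in> ?p ` B"
    then obtain u v where uv: "(u, v) \<in> B" "e = {u, v}" by auto
    have iff: "?p x = e \<longleftrightarrow> x = (u, v) \<or> x = (v, u)" for x
      using uv(2) by (cases x) (simp add: doubleton_eq_iff)
    have "(v, u) \<in> B" using uv(1) by (simp add: B_def)
    then have "{x\<in>B. ?p x = e} = {(u, v), (v, u)}" unfolding iff using uv(1) by auto
    moreover have "(u, v) \<noteq> (v, u)" using loop[of u v] uv(1) B(1) by auto
    ultimately show "card {x\<in>B. ?p x = e} = 2" by simp
  qed simp
  finally have cB: "card B = 2 * f2 G" using f2 by simp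
  have "(\<Sum>(u, v)\<in>?A. if (v, u) \<in> ?A then a / 2 else 1) =
    (\<Sum>(u, v)\<in>?A - B. if (v, u) \<in> ?A then a / 2 else 1) + (\<Sum>(u, v)\<in>B. if (v, u) \<in> ?A then a / 2 else 1)"
    using fin B by (intro sum.subset_diff) auto
  also have "(\<Sum>(u, v)\<in>?A - B. if (v, u) \<in> ?A then a / 2 else 1) = (\<Sum>e\<in>?A - B. 1)"
    by (intro sum.cong) (auto simp: B_def split: if_splits)
  also have "(\<Sum>(u, v)\<in>B. if (v, u) \<in> ?A then a / 2 else 1) = (\<Sum>e\<in>B. a / 2)"
    by (intro sum.cong) (auto simp: B_def split: if_splits)
  finally show ?thesis using f1 cB by (simp add: weighted_size_def)
qed

section \<open>A priori bounds and the extremal value\<close>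

lemma card_parcs_le:
  assumes "pair_digraph G"
  shows "card (parcs G) \<le> (card (pverts G))\<^sup>2"
proof -
  have "card (parcs G) \<le> card (pverts G \<times> pverts G)"
    using assms by (intro card_mono) (auto simp: pair_digraph_iff)
  then show ?thesis by (simp add: card_cartesian_product power2_eq_square)
qed

lemma f1_f2_le:
  assumes "pair_digraph G"
  shows "f1 G \<le> (card (pverts G))\<^sup>2" "f2 G \<le> (card (pverts G))\<^sup>2"
proof -
  have fin: "finite (parcs G)" using assms by (auto simp: pair_digraph_iff intro: finite_subset)
  have "f1 G \<le> card ((\<lambda>(u, v). {u, v}) ` parcs G)" "f2 G \<le> card ((\<lambda>(u, v). {u, v}) ` parcs G)"
    unfolding f1_def f2_def using fin by (auto intro!: card_mono)
  moreover have "card ((\<lambda>(u, v). {u, v}) ` parcs G) \<le> card (parcs G)" using fin by (rule card_image_le)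
  ultimately show "f1 G \<le> (card (pverts G))\<^sup>2" "f2 G \<le> (card (pverts G))\<^sup>2"
    using card_parcs_le[OF assms] by auto
qed

lemma weighted_size_le_max:
  assumes "pair_digraph G" "a \<ge> 1"
  shows "weighted_size a G \<le> a * (real (card (pverts G)))\<^sup>2"
proof -
  have "weighted_size a G \<le> (\<Sum>e\<in>parcs G. a)"
    unfolding weighted_size_eq_sum[OF assms(1)] using assms(2) by (intro sum_mono) auto
  also have "\<dots> = a * real (card (parcs G))" by simp
  also have "\<dots> \<le> a * real ((card (pverts G))\<^sup>2)"
    using card_parcs_le[OF assms(1)] assms(2) by (intro mult_left_mono) auto
  finally show ?thesis by simp
qed

lemma finite_weighted_sizes:
  "finite {weighted_size a G |G :: nat pair_pre_digraph. pair_digraph G \<and> card (pverts G) = n \<and> H_free H G}"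
proof (rule finite_subset)
  show "{weighted_size a G |G :: nat pair_pre_digraph. pair_digraph G \<and> card (pverts G) = n \<and> H_free H G}
    \<subseteq> (\<lambda>(i, j). a * real i + real j) ` ({..n\<^sup>2} \<times> {..n\<^sup>2})"
    using f1_f2_le by (fastforce simp: weighted_size_def)
qed simp

lemma weighted_size_le_ex_weighted:
  fixes G :: "nat pair_pre_digraph"
  assumes "pair_digraph G" "H_free H G"
  shows "weighted_size a G \<le> ex_weighted a (card (pverts G)) H"
  unfolding ex_weighted_def by (rule Max_ge[OF finite_weighted_sizes]) (use assms in auto)

text \<open>The arcless digraph is \<open>H\<close>-free as soon as \<open>H\<close> has an
  arc.\<close>

lemma ex_weighted_nonneg:
  assumes "pair_digraph H" "parcs H \<noteq> {}" "a \<ge> 1"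
  shows "ex_weighted a n H \<ge> 0"
proof -
  let ?G = "\<lparr>pverts = {1..n}, parcs = {}\<rparr> :: nat pair_pre_digraph"
  have G: "pair_digraph ?G" by (simp add: pair_digraph_iff)
  have "embeddings H ?G = {}" using assms(2) by (simp add: embeddings_def)
  then have "H_free H ?G" by (simp only: H_free_iff[OF assms(1) G])
  moreover have "weighted_size a ?G \<ge> 0" using assms by (simp add: weighted_size_def)
  ultimately show ?thesis using weighted_size_le_ex_weighted[OF G, of H a] by simp
qed

section \<open>Averaging over vertex subsets and supersaturation\<close>

lemma card_supersets_of_card:
  assumes "finite V" "T \<subseteq> V" "card T \<le> m"
  shows "card {U. U \<subseteq> V \<and> card U = m \<and> T \<subseteq> U} = (card V - card T) choose (m - card T)"
proof -
  have fT: "finite T" using assms finite_subset by blast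
  have "bij_betw (\<lambda>U. U - T) {U. U \<subseteq> V \<and> card U = m \<and> T \<subseteq> U} {U. U \<subseteq> V - T \<and> card U = m - card T}"
  proof (rule bij_betwI[where g = "\<lambda>U. U \<union> T"])
    show "(\<lambda>U. U - T) \<in> {U. U \<subseteq> V \<and> card U = m \<and> T \<subseteq> U} \<rightarrow> {U. U \<subseteq> V - T \<and> card U = m - card T}"
      using fT by (auto simp: card_Diff_subset)
    show "(\<lambda>U. U \<union> T) \<in> {U. U \<subseteq> V - T \<and> card U = m - card T} \<rightarrow> {U. U \<subseteq> V \<and> card U = m \<and> T \<subseteq> U}"
    proof (intro Pi_I CollectI conjI)
      fix U assume "U \<in> {U. U \<subseteq> V - T \<and> card U = m - card T}"
      then have U: "U \<subseteq> V - T" "card U = m - card T" by auto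
      then have "finite U" using assms(1) finite_subset by blast
      then have "card (U \<union> T) = card U + card T" using U fT by (intro card_Un_disjoint) auto
      then show "card (U \<union> T) = m" using U assms by simp
      show "U \<union> T \<subseteq> V" "T \<subseteq> U \<union> T" using U assms by auto
    qed
  qed auto
  then have "card {U. U \<subseteq> V \<and> card U = m \<and> T \<subseteq> U} = card {U. U \<subseteq> V - T \<and> card U = m - card T}"
    by (rule bij_betw_same_card)
  also have "\<dots> = card (V - T) choose (m - card T)" using assms by (intro n_subsets) auto
  also have "card (V - T) = card V - card T" using assms fT by (simp add: card_Diff_subset)
  finally show ?thesis .
qed

text \<open>Sum the weighted sizes of the induced subdigraphs over all \<open>m\<close>-sets of
  vertices. Every arc is counted \<open>(n - 2) choose (m - 2)\<close> times. An
  \<open>H\<close>-free induced subdigraph contributes at most the extremal value, any other at most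
  \<open>a * m\<^sup>2\<close>, where \<open>\<^sup>2\<close> denotes squaring; each embedding
  spoils only \<open>(n - h) choose (m - h)\<close> of the sets.\<close>

lemma subset_averaging:
  fixes G :: "nat pair_pre_digraph" and a :: real
  assumes H: "pair_digraph H" and G: "pair_digraph G" and a: "a \<ge> 1"
    and m: "card (pverts H) \<le> m" "2 \<le> m"
  defines "n \<equiv> card (pverts G)" and "h \<equiv> card (pverts H)"
  assumes ex0: "0 \<le> ex_weighted a m H"
  shows "weighted_size a G * real ((n - 2) choose (m - 2)) \<le> ex_weighted a m H * real (n choose m)
    + a * (real m)\<^sup>2 * real (card (embeddings H G)) * real ((n - h) choose (m - h))"
proof -
  let ?V = "pverts G" and ?A = "parcs G"
  let ?wt = "\<lambda>(u, v). if (v, u) \<in> ?A then a / 2 else 1"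
  define \<U> where "\<U> = {U. U \<subseteq> ?V \<and> card U = m}"
  have fV: "finite ?V" and AV: "?A \<subseteq> ?V \<times> ?V" using G by (auto simp: pair_digraph_iff)
  have fA: "finite ?A" using AV fV by (auto intro: finite_subset)
  have fU: "finite \<U>" using fV by (simp add: \<U>_def)
  define ind where "ind U = \<lparr>pverts = U, parcs = ?A \<inter> U \<times> U\<rparr>" for U
  have ind: "pair_digraph (ind U)" "card (pverts (ind U)) = m" if "U \<in> \<U>" for U
    using that G fV by (auto simp: pair_digraph_iff ind_def \<U>_def intro: finite_subset)
  define bad where "bad = {U\<in>\<U>. \<not> H_free H (ind U)}"
  have bad: "bad \<subseteq> \<U>" "finite bad" using fU by (auto simp: bad_def)

  have "card bad \<le> card (\<Union>\<phi>\<in>embeddings H G. {U. U \<subseteq> ?V \<and> card U = m \<and> \<phi> ` pverts H \<subseteq> U})"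
  proof (rule card_mono)
    show "finite (\<Union>\<phi>\<in>embeddings H G. {U. U \<subseteq> ?V \<and> card U = m \<and> \<phi> ` pverts H \<subseteq> U})"
      using fV by (auto intro: finite_subset[of _ "Pow ?V"])
    show "bad \<subseteq> (\<Union>\<phi>\<in>embeddings H G. {U. U \<subseteq> ?V \<and> card U = m \<and> \<phi> ` pverts H \<subseteq> U})"
    proof
      fix U assume U: "U \<in> bad"
      then have "U \<in> \<U>" "embeddings H (ind U) \<noteq> {}" using ind H_free_iff[OF H] by (auto simp: bad_def)
      then obtain \<phi> where \<phi>: "\<phi> \<in> embeddings H (ind U)" by blast
      then have "\<phi> \<in> embeddings H G" "\<phi> ` pverts H \<subseteq> U"
        using \<open>U \<in> \<U>\<close> by (auto simp: embeddings_def ind_def \<U>_def PiE_iff)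
      then show "U \<in> (\<Union>\<phi>\<in>embeddings H G. {U. U \<subseteq> ?V \<and> card U = m \<and> \<phi> ` pverts H \<subseteq> U})"
        using \<open>U \<in> \<U>\<close> by (auto simp: \<U>_def)
    qed
  qed
  also have "\<dots> \<le> (\<Sum>\<phi>\<in>embeddings H G. card {U. U \<subseteq> ?V \<and> card U = m \<and> \<phi> ` pverts H \<subseteq> U})"
    using H fV by (intro card_UN_le finite_embeddings) (auto simp: pair_digraph_iff)
  also have "\<dots> = (\<Sum>\<phi>\<in>embeddings H G. (n - h) choose (m - h))"
  proof (rule sum.cong)
    fix \<phi> assume "\<phi> \<in> embeddings H G"
    then have "card (\<phi> ` pverts H) = h" "\<phi> ` pverts H \<subseteq> ?V"
      by (auto simp: embeddings_def card_image h_def)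
    then show "card {U. U \<subseteq> ?V \<and> card U = m \<and> \<phi> ` pverts H \<subseteq> U} = (n - h) choose (m - h)"
      using card_supersets_of_card[OF fV, of "\<phi> ` pverts H" m] m by (simp add: n_def h_def)
  qed simp
  finally have "real (card bad) \<le> real (card (embeddings H G) * ((n - h) choose (m - h)))"
    by (subst of_nat_le_iff) simp
  then have cbad: "real (card bad) \<le> real (card (embeddings H G)) * real ((n - h) choose (m - h))"
    by simp

  have "weighted_size a G * real ((n - 2) choose (m - 2)) = (\<Sum>e\<in>?A. ?wt e * real ((n - 2) choose (m - 2)))"
    by (simp add: weighted_size_eq_sum[OF G] sum_distrib_right)
  also have "\<dots> = (\<Sum>e\<in>?A. \<Sum>U\<in>{U\<in>\<U>. e \<in> U \<times> U}. ?wt e)"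
  proof (rule sum.cong)
    fix e assume e: "e \<in> ?A"
    obtain u v where uv: "e = (u, v)" by (cases e)
    have "u \<noteq> v" "{u, v} \<subseteq> ?V" using e uv G by (auto simp: pair_digraph_iff)
    moreover have "{U\<in>\<U>. e \<in> U \<times> U} = {U. U \<subseteq> ?V \<and> card U = m \<and> {u, v} \<subseteq> U}" using uv by (auto simp: \<U>_def)
    ultimately have "card {U\<in>\<U>. e \<in> U \<times> U} = (n - 2) choose (m - 2)"
      using card_supersets_of_card[OF fV, of "{u, v}" m] m by (simp add: n_def numeral_2_eq_2)
    then show "?wt e * real ((n - 2) choose (m - 2)) = (\<Sum>U\<in>{U\<in>\<U>. e \<in> U \<times> U}. ?wt e)" by simp
  qed simp
  also have "\<dots> = (\<Sum>U\<in>\<U>. \<Sum>e\<in>{e\<in>?A. e \<in> U \<times> U}. ?wt e)"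
    using fA fU by (rule sum.swap_restrict)
  also have "\<dots> = (\<Sum>U\<in>\<U>. weighted_size a (ind U))"
  proof (rule sum.cong)
    fix U assume U: "U \<in> \<U>"
    \<comment> \<open>An arc inside \<open>U\<close> has its reverse inside \<open>U\<close> as
      well, so its weight is the same in \<open>G\<close> and in \<open>ind U\<close>.\<close>
    show "(\<Sum>e\<in>{e\<in>?A. e \<in> U \<times> U}. ?wt e) = weighted_size a (ind U)"
      unfolding weighted_size_eq_sum[OF ind(1)[OF U]] by (rule sum.cong) (auto simp: ind_def)
  qed simp
  also have "\<dots> = (\<Sum>U\<in>\<U> - bad. weighted_size a (ind U)) + (\<Sum>U\<in>bad. weighted_size a (ind U))"
    using fU bad by (intro sum.subset_diff) auto
  also have "\<dots> \<le> real (card (\<U> - bad)) * ex_weighted a m H + real (card bad) * (a * (real m)\<^sup>2)"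
  proof (intro add_mono sum_bounded_above)
    fix U assume "U \<in> \<U> - bad"
    then show "weighted_size a (ind U) \<le> ex_weighted a m H"
      using weighted_size_le_ex_weighted[of "ind U" H a] ind[of U] by (auto simp: bad_def)
  next
    fix U assume "U \<in> bad"
    then show "weighted_size a (ind U) \<le> a * (real m)\<^sup>2"
      using weighted_size_le_max[of "ind U" a] ind[of U] a bad by auto
  qed
  also have "\<dots> \<le> real (n choose m) * ex_weighted a m H
    + (real (card (embeddings H G)) * real ((n - h) choose (m - h))) * (a * (real m)\<^sup>2)"
  proof (intro add_mono mult_right_mono cbad ex0)
    have "card (\<U> - bad) \<le> card \<U>" using fU by (intro card_mono) auto
    also have "card \<U> = n choose m" using n_subsets[OF fV] by (simp add: \<U>_def n_def)
    finally show "real (card (\<U> - bad)) \<le> real (n choose m)" by simp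
  qed (use a in simp)
  finally show ?thesis by (simp add: algebra_simps)
qed

lemma choose_two_le: "real (n choose 2) \<le> (real n)\<^sup>2 / 2"
proof -
  have "2 * (n choose 2) \<le> n * (n - 1)" unfolding choose_two by simp
  also have "\<dots> \<le> n * n" by simp
  finally have "2 * (n choose 2) \<le> n * n" .
  then have "real (2 * (n choose 2)) \<le> real (n * n)" by (rule of_nat_mono)
  then show ?thesis by (simp add: power2_eq_square)
qed

text \<open>Let \<open>D n\<close> be the extremal value divided by \<open>n choose 2\<close>, and
  fix \<open>m\<close> with \<open>D m\<close> within \<open>\<epsilon>\<close> of the infimum
  \<open>\<pi>\<close>. Averaging over \<open>m\<close>-sets bounds the normalised weighted size of
  \<open>G\<close> by \<open>D m\<close> plus an error proportional to the number of embeddings.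
  Since \<open>\<pi> \<le> D n\<close>, this is at most \<open>D n\<close> plus small errors;
  \<open>m\<close> itself serves as the threshold for the number of vertices.\<close>

lemma supersaturation:
  fixes H :: "'a pair_pre_digraph" and a \<epsilon> :: real
  assumes H: "pair_digraph H" "parcs H \<noteq> {}" and a: "a \<ge> 1" and \<epsilon>: "\<epsilon> > 0"
  shows "\<exists>\<eta>>0. \<exists>N\<^sub>0. \<forall>G :: nat pair_pre_digraph. pair_digraph G \<longrightarrow> card (pverts G) \<ge> N\<^sub>0 \<longrightarrow>
    real (card (embeddings H G)) \<le> \<eta> * real (card (pverts G)) ^ card (pverts H) \<longrightarrow>
    weighted_size a G \<le> ex_weighted a (card (pverts G)) H + \<epsilon> * (real (card (pverts G)))\<^sup>2"
proof -
  define h where "h = card (pverts H)"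
  define D where "D n = ex_weighted a n H / real (n choose 2)" for n
  have ex0: "ex_weighted a n H \<ge> 0" for n by (rule ex_weighted_nonneg[OF H a])
  define \<pi> where "\<pi> = Inf (D ` {max h 2..})"
  \<comment> \<open>Taking \<open>m\<close> close to the infimum of the densities avoids proving that they are monotone.\<close>
  have bdd: "bdd_below (D ` {max h 2..})"
    by (rule bdd_belowI[of _ 0]) (use ex0 in \<open>auto simp: D_def\<close>)
  have "Inf (D ` {max h 2..}) < \<pi> + \<epsilon>" using \<epsilon> by (simp add: \<pi>_def)
  then obtain m where m: "m \<ge> h" "m \<ge> 2" "D m < \<pi> + \<epsilon>"
    using cInf_lessD[of "D ` {max h 2..}" "\<pi> + \<epsilon>"] by auto
  \<comment> \<open>\<open>C\<close> collects the factors of the error term; \<open>h ^ h\<close>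
    enters through \<open>n ^ h \<le> h ^ h * (n choose h)\<close>. The summand 1 in
    \<open>\<eta>\<close> keeps the denominator positive.\<close>
  define C where "C = a * (real m)\<^sup>2 * real h ^ h * real (m choose h)"
  have C: "C \<ge> 0" using a by (simp add: C_def)
  define \<eta> where "\<eta> = \<epsilon> / (C + 1)"
  have \<eta>: "\<eta> > 0" using C \<epsilon> by (simp add: \<eta>_def)
  have "weighted_size a G \<le> ex_weighted a n H + \<epsilon> * (real n)\<^sup>2"
    if G: "pair_digraph G" and n: "n = card (pverts G)" "n \<ge> m"
      and emb: "real (card (embeddings H G)) \<le> \<eta> * real n ^ h" for G :: "nat pair_pre_digraph" and n
  proof -
    let ?e = "real (card (embeddings H G))"
    let ?P = "real (n choose m)" and ?p2 = "real (m choose 2)" and ?q2 = "real (n choose 2)"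
    let ?ph = "real (m choose h)" and ?qh = "real (n choose h)"
    let ?R2 = "real ((n - 2) choose (m - 2))" and ?Rh = "real ((n - h) choose (m - h))"
    have hn: "h \<le> n" using m n by simp
    have P: "?P > 0" "?qh > 0" "?p2 \<ge> 1" "?q2 > 0" using m n hn by (auto simp: Suc_le_eq)
    \<comment> \<open>The next two identities trade the binomials counting supersets for
      \<open>n choose m\<close>, which then cancels.\<close>
    have "real ((n choose m) * (m choose 2)) = real ((n choose 2) * ((n - 2) choose (m - 2)))"
      using choose_mult[of 2 m n] m n by simp
    then have id2: "?P * ?p2 = ?q2 * ?R2" by simp
    have "real ((n choose m) * (m choose h)) = real ((n choose h) * ((n - h) choose (m - h)))"
      using choose_mult[of h m n] m n by simp
    then have idh: "?P * ?ph = ?qh * ?Rh" by simp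
    have "weighted_size a G * ?R2 \<le> ex_weighted a m H * ?P + a * (real m)\<^sup>2 * ?e * ?Rh"
      using subset_averaging[OF H(1) G a _ m(2)] m(1) ex0 n(1) by (simp add: h_def)
    then have "(weighted_size a G * ?R2) * ?q2 \<le> (ex_weighted a m H * ?P + a * (real m)\<^sup>2 * ?e * ?Rh) * ?q2"
      by (rule mult_right_mono) simp
    also have "(weighted_size a G * ?R2) * ?q2 = (weighted_size a G * ?p2) * ?P" using id2 by (simp add: algebra_simps)
    also have "?Rh = ?P * ?ph / ?qh" using idh P by (simp add: field_simps)
    also have "(ex_weighted a m H * ?P + a * (real m)\<^sup>2 * ?e * (?P * ?ph / ?qh)) * ?q2
      = (ex_weighted a m H * ?q2 + a * (real m)\<^sup>2 * ?e * ?ph / ?qh * ?q2) * ?P" by (simp add: algebra_simps)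
    finally have "weighted_size a G * ?p2 \<le> ex_weighted a m H * ?q2 + a * (real m)\<^sup>2 * ?e * ?ph / ?qh * ?q2"
      using P by simp
    also have "ex_weighted a m H = D m * ?p2"
      unfolding D_def using P(3) by (intro nonzero_divide_eq_eq[THEN iffD1, OF _ refl]) linarith
    \<comment> \<open>Enlarging the error by the factor \<open>m choose 2\<close>, which is at least
      1, makes this factor common to both sides.\<close>
    also have "D m * ?p2 * ?q2 + a * (real m)\<^sup>2 * ?e * ?ph / ?qh * ?q2
      \<le> D m * ?p2 * ?q2 + (a * (real m)\<^sup>2 * ?e * ?ph / ?qh * ?q2) * ?p2"
    proof (rule add_left_mono)
      have "0 \<le> a * (real m)\<^sup>2 * ?e * ?ph / ?qh * ?q2" using a by simp
      from mult_left_mono[OF P(3) this]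
      show "a * (real m)\<^sup>2 * ?e * ?ph / ?qh * ?q2 \<le> (a * (real m)\<^sup>2 * ?e * ?ph / ?qh * ?q2) * ?p2" by simp
    qed
    finally have "weighted_size a G * ?p2 \<le> (D m * ?q2 + a * (real m)\<^sup>2 * ?e * ?ph / ?qh * ?q2) * ?p2"
      by (simp only: algebra_simps)
    then have "weighted_size a G \<le> D m * ?q2 + a * (real m)\<^sup>2 * ?e * ?ph / ?qh * ?q2"
      by (rule mult_right_le_imp_le) (use P(3) in linarith)
    also have "\<dots> \<le> (\<pi> + \<epsilon>) * ?q2 + \<epsilon> * ?q2"
    proof (intro add_mono mult_right_mono)
      have "?e \<le> \<eta> * real n ^ h" by (rule emb)
      also have "real n ^ h \<le> real h ^ h * ?qh"
      proof -
        have "(real n / real h) ^ h \<le> ?qh" by (rule binomial_ge_n_over_k_pow_k[OF hn])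
        then show ?thesis by (cases "h = 0") (auto simp: power_divide field_simps)
      qed
      finally have "?e / ?qh \<le> \<eta> * real h ^ h" using \<eta> P by (simp add: field_simps)
      then have "a * (real m)\<^sup>2 * ?ph * (?e / ?qh) \<le> a * (real m)\<^sup>2 * ?ph * (\<eta> * real h ^ h)"
        using a by (intro mult_left_mono) auto
      also have "\<dots> = C * \<eta>" by (simp add: C_def)
      also have "\<dots> \<le> \<epsilon>" using C \<epsilon> by (simp add: \<eta>_def field_simps)
      finally show "a * (real m)\<^sup>2 * ?e * ?ph / ?qh \<le> \<epsilon>" by (simp add: algebra_simps)
    qed (use m in auto)
    \<comment> \<open>One \<open>\<epsilon>\<close> comes from the choice of \<open>m\<close>, the
      other from the embeddings. As \<open>n choose 2\<close> is at most half of the square of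
      \<open>n\<close>, the total error is as claimed.\<close>
    also have "\<dots> = \<pi> * ?q2 + 2 * \<epsilon> * ?q2" by (simp add: algebra_simps)
    also have "\<dots> \<le> D n * ?q2 + 2 * \<epsilon> * ((real n)\<^sup>2 / 2)"
    proof (intro add_mono mult_right_mono mult_left_mono choose_two_le)
      show "\<pi> \<le> D n" unfolding \<pi>_def using m n by (intro cInf_lower bdd) auto
    qed (use \<epsilon> in auto)
    also have "D n * ?q2 = ex_weighted a n H" using P by (simp add: D_def)
    finally show ?thesis by simp
  qed
  then show ?thesis using \<eta> unfolding h_def by blast
qed

section \<open>Codegrees of the hypergraph of copies\<close>

text \<open>First choose, for each vertex of \<open>W\<close>, the vertex of \<open>H\<close> mapped
  to it: at most \<open>h ^ h\<close> ways with \<open>h = card (pverts H)\<close>. The remaining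
  \<open>h - card W\<close> vertices of \<open>H\<close> then have at most
  \<open>card (pverts G)\<close> images each.\<close>

lemma card_embeddings_extending_le:
  assumes H: "finite (pverts H)" and W: "finite W" and G: "finite (pverts G)"
  shows "card {\<phi> \<in> embeddings H G. W \<subseteq> \<phi> ` pverts H}
    \<le> card (pverts H) ^ card (pverts H) * card (pverts G) ^ (card (pverts H) - card W)"
proof (cases "{\<phi> \<in> embeddings H G. W \<subseteq> \<phi> ` pverts H} = {}")
  case False
  let ?P = "pverts H"
  define X where "X \<psi> = {\<phi> \<in> embeddings H G. \<forall>x\<in>W. \<psi> x \<in> ?P \<and> \<phi> (\<psi> x) = x}" for \<psi>
  from False obtain \<phi>\<^sub>0 where "W \<subseteq> \<phi>\<^sub>0 ` ?P" by blast
  then have cW: "card W \<le> card ?P" using H by (meson card_image_le card_mono finite_imageI le_trans)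
  have X: "card (X \<psi>) \<le> card (pverts G) ^ (card ?P - card W)" if "\<psi> \<in> W \<rightarrow>\<^sub>E ?P" for \<psi>
  proof (cases "X \<psi> = {}")
    case False
    then obtain \<phi>\<^sub>1 where "\<forall>x\<in>W. \<psi> x \<in> ?P \<and> \<phi>\<^sub>1 (\<psi> x) = x" by (auto simp: X_def)
    then have inj: "inj_on \<psi> W" by (metis inj_onI)
    let ?R = "?P - \<psi> ` W"
    have "card (X \<psi>) \<le> card (?R \<rightarrow>\<^sub>E pverts G)"
    proof (rule card_inj_on_le)
      show "inj_on (\<lambda>\<phi>. restrict \<phi> ?R) (X \<psi>)"
      proof (rule inj_onI)
        fix \<phi> \<phi>' assume *: "\<phi> \<in> X \<psi>" "\<phi>' \<in> X \<psi>" "restrict \<phi> ?R = restrict \<phi>' ?R"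
        have ext: "\<phi> \<in> extensional ?P" "\<phi>' \<in> extensional ?P"
          using * by (auto simp: X_def embeddings_def PiE_def)
        show "\<phi> = \<phi>'"
        proof (rule extensionalityI[OF ext])
          fix y assume y: "y \<in> ?P"
          show "\<phi> y = \<phi>' y"
          proof (cases "y \<in> \<psi> ` W")
            case True
            then show ?thesis using *(1,2) by (auto simp: X_def)
          next
            case False
            then show ?thesis using fun_cong[OF *(3), of y] y by simp
          qed
        qed
      qed
      show "(\<lambda>\<phi>. restrict \<phi> ?R) ` X \<psi> \<subseteq> ?R \<rightarrow>\<^sub>E pverts G"
        by (auto simp: X_def embeddings_def PiE_iff split: if_splits)
      show "finite (?R \<rightarrow>\<^sub>E pverts G)" using H G by (simp add: finite_PiE)
    qed
    also have "\<dots> = card (pverts G) ^ card ?R" using H by (subst card_PiE) auto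
    also have "card ?R = card ?P - card W"
      using that inj W by (subst card_Diff_subset) (auto simp: card_image)
    finally show ?thesis .
  qed simp
  have fin: "finite (W \<rightarrow>\<^sub>E ?P)" using W H by (simp add: finite_PiE)
  have "{\<phi> \<in> embeddings H G. W \<subseteq> \<phi> ` ?P} \<subseteq> (\<Union>\<psi>\<in>W \<rightarrow>\<^sub>E ?P. X \<psi>)"
  proof
    fix \<phi> assume \<phi>: "\<phi> \<in> {\<phi> \<in> embeddings H G. W \<subseteq> \<phi> ` ?P}"
    then have "\<forall>x\<in>W. \<exists>y. y \<in> ?P \<and> \<phi> y = x" by blast
    from bchoice[OF this] obtain \<psi> where \<psi>: "\<forall>x\<in>W. \<psi> x \<in> ?P \<and> \<phi> (\<psi> x) = x" by blast
    then have "restrict \<psi> W \<in> W \<rightarrow>\<^sub>E ?P" "\<phi> \<in> X (restrict \<psi> W)" using \<phi> by (auto simp: X_def)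
    then show "\<phi> \<in> (\<Union>\<psi>\<in>W \<rightarrow>\<^sub>E ?P. X \<psi>)" by blast
  qed
  then have "card {\<phi> \<in> embeddings H G. W \<subseteq> \<phi> ` ?P} \<le> card (\<Union>\<psi>\<in>W \<rightarrow>\<^sub>E ?P. X \<psi>)"
    using finite_embeddings[OF H G] fin by (intro card_mono) (auto simp: X_def)
  also have "\<dots> \<le> (\<Sum>\<psi>\<in>W \<rightarrow>\<^sub>E ?P. card (X \<psi>))" by (rule card_UN_le[OF fin])
  also have "\<dots> \<le> of_nat (card (W \<rightarrow>\<^sub>E ?P)) * card (pverts G) ^ (card ?P - card W)"
    using X by (rule sum_bounded_above)
  also have "card (W \<rightarrow>\<^sub>E ?P) = card ?P ^ card W" using W by (subst card_PiE) auto
  also have "card ?P ^ card W \<le> card ?P ^ card ?P"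
  proof (cases "card ?P = 0")
    case True
    then show ?thesis using cW by simp
  qed (use cW in \<open>simp add: power_increasing\<close>)
  finally show ?thesis by (simp add: mult_right_mono)
next
  case True
  then show ?thesis by (simp only: card.empty)
qed

section \<open>Vertex and arc counts in oriented graphs\<close>

lemma oriented_graph_imp_pair_digraph: "oriented_graph H \<Longrightarrow> pair_digraph H"
  by (simp add: oriented_graph_def)

text \<open>Two distinct arcs on the same two vertices would be opposite to each other. This is
  where orientedness of \<open>H\<close> enters; it keeps the denominators in
  \<open>m_density\<close> positive.\<close>

lemma oriented_two_arcs_card_verts:
  assumes H: "oriented_graph H" and e: "e \<in> parcs H" "e' \<in> parcs H" "e \<noteq> e'"
  shows "3 \<le> card {fst e, snd e, fst e', snd e'}"
proof -
  have "(snd e, fst e) \<noteq> e'" using oriented_graph.no_opposite_arcs[OF H, of "fst e" "snd e"] e by auto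
  moreover have loop: "fst e \<noteq> snd e" "fst e' \<noteq> snd e'"
    using oriented_graph_imp_pair_digraph[OF H] e by (auto simp: pair_digraph_iff)
  ultimately have "\<exists>x\<in>{fst e', snd e'}. x \<notin> {fst e, snd e}"
    using e(3) by (cases e; cases e') auto
  then obtain x where x: "x \<in> {fst e', snd e'}" "x \<notin> {fst e, snd e}" by blast
  then have "card {fst e, snd e, x} = 3" using loop by auto
  moreover have "card {fst e, snd e, x} \<le> card {fst e, snd e, fst e', snd e'}"
    using x by (intro card_mono) auto
  ultimately show ?thesis by simp
qed

lemma finite_densities:
  assumes "pair_digraph H"
  shows "finite {(real (card (parcs K)) - 1) / (real (card (pverts K)) - 2) |K.
     subgraph (with_proj K) (with_proj H) \<and> card (parcs K) > 1}"
proof (rule finite_subset)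
  let ?f = "\<lambda>(P, Q). (real (card Q) - 1) / (real (card P) - 2)"
  show "{(real (card (parcs K)) - 1) / (real (card (pverts K)) - 2) |K.
     subgraph (with_proj K) (with_proj H) \<and> card (parcs K) > 1} \<subseteq> ?f ` (Pow (pverts H) \<times> Pow (parcs H))"
    by (fastforce simp: subgraph_with_proj)
  show "finite (?f ` (Pow (pverts H) \<times> Pow (parcs H)))"
    using assms finite_parcs[OF assms] by (simp add: pair_digraph_iff)
qed

lemma density_le_m_density:
  assumes "pair_digraph H" "P \<subseteq> pverts H" "Q \<subseteq> parcs H" "Q \<subseteq> P \<times> P" "card Q > 1"
  shows "(real (card Q) - 1) / (real (card P) - 2) \<le> m_density H"
proof -
  have "subgraph (with_proj \<lparr>pverts = P, parcs = Q\<rparr>) (with_proj H)"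
    using assms by (auto simp: subgraph_with_proj pair_digraph_iff)
  then show ?thesis unfolding m_density_def
    by (intro Max_ge[OF finite_densities[OF assms(1)]] CollectI exI[of _ "\<lparr>pverts = P, parcs = Q\<rparr>"])
       (use assms in auto)
qed

lemma two_elements_of_card:
  assumes "card A \<ge> 2"
  obtains x y where "x \<in> A" "y \<in> A" "x \<noteq> y"
proof -
  have "\<not> card A \<le> Suc 0" "finite A" using assms card.infinite[of A] by fastforce+
  then show ?thesis using that card_le_Suc0_iff_eq[of A] by blast
qed

text \<open>Any two arcs span at most four vertices, which gives density at least
  \<open>1 / (4 - 2)\<close>. The bound makes \<open>m_density H\<close> positive and the exponent
  \<open>2 - 1 / m_density H\<close> nonnegative.\<close>

lemma m_density_ge_half:
  assumes H: "oriented_graph H" and card: "card (parcs H) \<ge> 2"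
  shows "m_density H \<ge> 1 / 2"
proof -
  note dH = oriented_graph_imp_pair_digraph[OF H]
  obtain e e' where e: "e \<in> parcs H" "e' \<in> parcs H" "e \<noteq> e'"
    using two_elements_of_card[OF card] .
  let ?P = "{fst e, snd e, fst e', snd e'}"
  have "real (card {e, e'}) - 1 = 1" using e by simp
  moreover have "(real (card {e, e'}) - 1) / (real (card ?P) - 2) \<le> m_density H"
    by (rule density_le_m_density[OF dH]) (use e dH in \<open>auto simp: pair_digraph_iff mem_Times_iff\<close>)
  moreover have "3 \<le> card ?P" by (rule oriented_two_arcs_card_verts[OF H e])
  moreover have "card ?P \<le> 4" using card_length[of "[fst e, snd e, fst e', snd e']"] by simp
  then have "1 / 2 \<le> 1 / (real (card ?P) - 2)" using \<open>3 \<le> card ?P\<close> by (intro divide_left_mono) auto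
  ultimately show ?thesis by (simp only:)
qed

text \<open>The definition of \<open>m_density\<close> with denominators cleared, applied to the
  subgraph formed by \<open>Q\<close> and its endpoints. It extends to a single arc, where the left
  side is 0.\<close>

lemma arcs_le_m_density:
  assumes H: "oriented_graph H" "card (parcs H) \<ge> 2" and Q: "Q \<subseteq> parcs H" "Q \<noteq> {}"
  shows "2 \<le> card (Field Q)" "real (card Q) - 1 \<le> m_density H * (real (card (Field Q)) - 2)"
proof -
  note dH = oriented_graph_imp_pair_digraph[OF H(1)]
  have fP: "Field Q \<subseteq> pverts H" using Q dH by (auto simp: pair_digraph_iff Field_def)
  have "finite (pverts H)" using dH by (simp add: pair_digraph_iff)
  then have fin: "finite (Field Q)" by (rule finite_subset[OF fP])
  obtain u v where uv: "(u, v) \<in> Q" using Q by auto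
  then have "u \<noteq> v" using Q dH by (auto simp: pair_digraph_iff)
  then have "card {u, v} = 2" by simp
  moreover have "card {u, v} \<le> card (Field Q)" using fin uv by (intro card_mono) (auto simp: Field_def)
  ultimately show two: "2 \<le> card (Field Q)" by simp
  have m: "m_density H \<ge> 0" using m_density_ge_half[OF H] by simp
  show "real (card Q) - 1 \<le> m_density H * (real (card (Field Q)) - 2)"
  proof (cases "card Q > 1")
    case True
    then have "card Q \<ge> 2" by simp
    then obtain e e' where e: "e \<in> Q" "e' \<in> Q" "e \<noteq> e'" by (rule two_elements_of_card)
    have "3 \<le> card {fst e, snd e, fst e', snd e'}"
      using oriented_two_arcs_card_verts[OF H(1)] e Q by blast
    also have "\<dots> \<le> card (Field Q)"
    proof (rule card_mono[OF fin])
      show "{fst e, snd e, fst e', snd e'} \<subseteq> Field Q"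
        using e by (auto simp: Field_def Domain_fst Range_snd)
    qed
    finally have "real (card (Field Q)) - 2 > 0" by simp
    moreover have "(real (card Q) - 1) / (real (card (Field Q)) - 2) \<le> m_density H"
      by (rule density_le_m_density[OF dH fP Q(1) _ True]) (auto simp: Field_def)
    ultimately show ?thesis by (simp add: pos_divide_le_eq)
  next
    case False
    then have "real (card Q) - 1 \<le> 0" by simp
    also have "\<dots> \<le> m_density H * (real (card (Field Q)) - 2)" using m two by simp
    finally show ?thesis .
  qed
qed

text \<open>The hypergraph whose vertices are the arcs of \<open>G\<close>. Counting embeddings rather than copies only
  changes the counts by a constant factor.\<close>

definition copy_weight :: "'a pair_pre_digraph \<Rightarrow> 'b pair_pre_digraph \<Rightarrow> ('b \<times> 'b) set \<Rightarrow> real" where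
  "copy_weight H G E = real (card {\<phi> \<in> embeddings H G. map_prod \<phi> \<phi> ` parcs H = E})"

lemma uniform_copy_weight:
  assumes "pair_digraph H" "pair_digraph G"
  shows "uniform_weight (parcs G) (card (parcs H)) (copy_weight H G)"
  unfolding uniform_weight_def
proof (intro allI conjI impI)
  fix E
  show "0 \<le> copy_weight H G E" by (simp add: copy_weight_def)
  assume "copy_weight H G E \<noteq> 0"
  then have "{\<phi> \<in> embeddings H G. map_prod \<phi> \<phi> ` parcs H = E} \<noteq> {}"
    unfolding copy_weight_def by (metis card.empty of_nat_0)
  then obtain \<phi> where \<phi>: "\<phi> \<in> embeddings H G" "E = map_prod \<phi> \<phi> ` parcs H" by auto
  then show "E \<subseteq> parcs G" by (simp add: embeddings_def)
  have inj: "inj_on \<phi> (pverts H)" using \<phi> by (simp add: embeddings_def)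
  have "parcs H \<subseteq> pverts H \<times> pverts H" using assms(1) by (simp add: pair_digraph_iff)
  then have "inj_on (map_prod \<phi> \<phi>) (parcs H)"
    by (rule inj_on_subset[OF map_prod_inj_on[OF inj inj]])
  then show "card E = card (parcs H)" using \<phi> by (simp add: card_image)
qed

text \<open>The edges above \<open>T\<close> partition the embeddings whose image contains
  \<open>T\<close> according to their sets of image arcs.\<close>

lemma codegree_copy_weight:
  assumes H: "pair_digraph H" and G: "pair_digraph G"
  shows "codegree (parcs G) (copy_weight H G) T =
    real (card {\<phi> \<in> embeddings H G. T \<subseteq> map_prod \<phi> \<phi> ` parcs H})"
proof -
  let ?S = "{\<phi> \<in> embeddings H G. T \<subseteq> map_prod \<phi> \<phi> ` parcs H}"
  let ?Es = "{E. E \<subseteq> parcs G \<and> T \<subseteq> E}"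
  have fG: "finite (parcs G)" using G finite_parcs by (auto simp: pair_digraph_iff)
  have fS: "finite ?S" using finite_embeddings[of H G] H G by (simp add: pair_digraph_iff)
  have "card ?S = (\<Sum>E\<in>?Es. card {\<phi> \<in> ?S. map_prod \<phi> \<phi> ` parcs H = E})"
    using fS fG unfolding card_eq_sum by (intro sum.group[symmetric]) (auto simp: embeddings_def)
  also have "\<dots> = (\<Sum>E\<in>?Es. card {\<phi> \<in> embeddings H G. map_prod \<phi> \<phi> ` parcs H = E})"
    by (intro sum.cong refl arg_cong[where f = card]) auto
  finally show ?thesis by (simp add: codegree_def copy_weight_def)
qed

text \<open>If \<open>j\<close> arcs of \<open>G\<close> lie in a common copy, they correspond to
  \<open>j\<close> arcs of \<open>H\<close> and so span at least
  \<open>2 + (j - 1) / m_density H\<close> vertices. Fixing these vertices leaves at most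
  \<open>h ^ h * n powr (h - 2 - (j - 1) / m_density H)\<close> embeddings, and
  \<open>n powr (- (j - 1) / m_density H)\<close> is the factor
  \<open>\<tau> ^ (j - 1)\<close>.\<close>

lemma codegrees_bounded_copy_weight:
  fixes H :: "'a pair_pre_digraph" and G :: "'b pair_pre_digraph"
  assumes H: "oriented_graph H" "card (parcs H) \<ge> 2" and G: "pair_digraph G"
    and n: "n = card (pverts G)" "n \<ge> 1" and h: "h = card (pverts H)"
  shows "codegrees_bounded (parcs G) (copy_weight H G) (real h ^ h)
    (real n powr (- 1 / m_density H)) (real n ^ (h - 2))"
  unfolding codegrees_bounded_def
proof (intro allI impI)
  fix T assume T: "T \<subseteq> parcs G" "T \<noteq> {}"
  note dH = oriented_graph_imp_pair_digraph[OF H(1)]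
  let ?\<tau> = "real n powr (- 1 / m_density H)"
  let ?S = "{\<phi> \<in> embeddings H G. T \<subseteq> map_prod \<phi> \<phi> ` parcs H}"
  have H': "parcs H \<subseteq> pverts H \<times> pverts H" "finite (pverts H)" using dH by (auto simp: pair_digraph_iff)
  have G': "finite (pverts G)" "finite (parcs G)" using G finite_parcs by (auto simp: pair_digraph_iff)
  have fT: "finite T" using T G' by (blast intro: finite_subset)
  have fW: "finite (Field T)" using fT by (rule finite_Field)
  show "codegree (parcs G) (copy_weight H G) T \<le> real h ^ h * ?\<tau> ^ (card T - 1) * real n ^ (h - 2)"
  proof (cases "?S = {}")
    case True
    then show ?thesis unfolding codegree_copy_weight[OF dH G] by (simp only: card.empty) simp
  next
    case False
    then obtain \<phi> where \<phi>: "\<phi> \<in> embeddings H G" "T \<subseteq> map_prod \<phi> \<phi> ` parcs H" by blast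
    \<comment> \<open>A single embedding pulls \<open>T\<close> back to a set \<open>Q\<close> of as
      many arcs of \<open>H\<close>, spanning as many vertices, so that the density bound for
      subgraphs of \<open>H\<close> applies to \<open>T\<close>.\<close>
    obtain Q where Q0: "Q \<subseteq> parcs H" and TQ: "T = map_prod \<phi> \<phi> ` Q"
      using \<phi>(2) unfolding subset_image_iff by (elim exE conjE)
    have inj: "inj_on \<phi> (pverts H)" using \<phi> by (simp add: embeddings_def)
    have Q: "Q \<subseteq> parcs H" "Q \<noteq> {}" using TQ T(2) Q0 by auto
    have "inj_on (map_prod \<phi> \<phi>) Q"
      using Q H' by (intro inj_on_subset[OF map_prod_inj_on[OF inj inj]]) auto
    then have cT: "card T = card Q" using TQ by (simp add: card_image)
    have FT: "Field T = \<phi> ` Field Q" unfolding TQ by (force simp: Field_def)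
    have FQ: "Field Q \<subseteq> pverts H" using Q H' by (auto simp: Field_def)
    then have cF: "card (Field T) = card (Field Q)" using FT inj by (metis card_image inj_on_subset)
    have ch: "card (Field T) \<le> h" unfolding cF h using FQ H' by (intro card_mono)
    note m = arcs_le_m_density[OF H Q]
    have mpos: "m_density H > 0" using m_density_ge_half[OF H] by simp
    have cTpos: "card T \<ge> 1" using T fT by (simp add: Suc_le_eq card_gt_0_iff)
    have "card ?S \<le> card {\<phi> \<in> embeddings H G. Field T \<subseteq> \<phi> ` pverts H}"
    proof (rule card_mono)
      show "finite {\<phi> \<in> embeddings H G. Field T \<subseteq> \<phi> ` pverts H}"
        using finite_embeddings[OF H'(2) G'(1)] by simp
      show "?S \<subseteq> {\<phi> \<in> embeddings H G. Field T \<subseteq> \<phi> ` pverts H}"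
        using H'(1) by (fastforce simp: Field_def)
    qed
    also have "\<dots> \<le> h ^ h * n ^ (h - card (Field T))"
      using card_embeddings_extending_le[OF H'(2) fW G'(1)] by (simp add: h n)
    finally have "real (card ?S) \<le> real (h ^ h * n ^ (h - card (Field T)))" by (rule of_nat_mono)
    also have "\<dots> = real h ^ h * real n ^ (h - card (Field T))" by simp
    also have "real n ^ (h - card (Field T)) \<le> ?\<tau> ^ (card T - 1) * real n ^ (h - 2)"
    proof -
      have "real n ^ (h - card (Field T)) = real n powr (real h - real (card (Field T)))"
        using n ch by (simp add: powr_realpow[symmetric] of_nat_diff)
      also have "\<dots> \<le> real n powr (- 1 / m_density H * (real (card T) - 1) + (real h - 2))"
      proof (rule powr_mono)
        have "(real (card T) - 1) / m_density H \<le> real (card (Field T)) - 2"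
          using m(2) mpos cT cF by (simp add: pos_divide_le_eq mult.commute)
        then show "real h - real (card (Field T)) \<le> - 1 / m_density H * (real (card T) - 1) + (real h - 2)"
          by simp
      qed (use n in simp)
      also have "\<dots> = ?\<tau> powr (real (card T) - 1) * real n powr (real h - 2)"
        by (simp only: powr_add powr_powr)
      also have "?\<tau> powr (real (card T) - 1) = ?\<tau> ^ (card T - 1)"
        using n cTpos by (simp add: powr_realpow[symmetric] of_nat_diff)
      also have "real n powr (real h - 2) = real n ^ (h - 2)"
        using n ch m(1) cF by (simp add: powr_realpow[symmetric] of_nat_diff)
      finally show ?thesis .
    qed
    finally show ?thesis unfolding codegree_copy_weight[OF dH G]
      by (simp add: mult.assoc mult_left_mono)
  qed
qed

section \<open>Containers for digraphs\<close>

lemma embeddings_subset_arcs: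
  assumes "\<phi> \<in> embeddings H G" "pverts I = pverts G" "map_prod \<phi> \<phi> ` parcs H \<subseteq> parcs I"
  shows "\<phi> \<in> embeddings H I"
  using assms by (simp add: embeddings_def)

lemma card_verts_ge_3:
  assumes "oriented_graph H" "card (parcs H) \<ge> 2"
  shows "card (pverts H) \<ge> 3"
proof -
  have dH: "pair_digraph H" by (rule oriented_graph_imp_pair_digraph[OF assms(1)])
  obtain e e' where e: "e \<in> parcs H" "e' \<in> parcs H" "e \<noteq> e'" using two_elements_of_card[OF assms(2)] .
  have "3 \<le> card {fst e, snd e, fst e', snd e'}" by (rule oriented_two_arcs_card_verts[OF assms(1) e])
  also have "\<dots> \<le> card (pverts H)"
    using e dH by (intro card_mono) (auto simp: pair_digraph_iff mem_Times_iff)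
  finally show ?thesis .
qed

text \<open>Sum the codegree bound over single arcs, where the power of \<open>\<tau>\<close> is
  trivial. This turns a small number of arcs into a small number of embeddings.\<close>

lemma card_embeddings_le_arcs:
  assumes H: "oriented_graph H" "card (parcs H) \<ge> 2" and G: "pair_digraph G"
    and n: "n = card (pverts G)" "n \<ge> 1" and h: "h = card (pverts H)"
  shows "real (card (embeddings H G)) \<le> real (card (parcs G)) * (real h ^ h * real n ^ (h - 2))"
proof -
  note dH = oriented_graph_imp_pair_digraph[OF H(1)]
  let ?w = "copy_weight H G" and ?A = "parcs G"
  have "real (card (embeddings H G)) = codegree ?A ?w {}"
    by (simp add: codegree_copy_weight[OF dH G])
  also have "\<dots> = 1 * codegree ?A ?w {}" by simp
  also have "\<dots> \<le> real (card (parcs H)) * codegree ?A ?w {}"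
    using H(2) by (intro mult_right_mono) (auto simp: codegree_copy_weight[OF dH G])
  also have "\<dots> = (\<Sum>e\<in>?A. codegree ?A ?w {e})"
    using sum_codegree_singletons[OF finite_parcs[OF G] uniform_copy_weight[OF dH G]] by simp
  also have "\<dots> \<le> of_nat (card ?A) * (real h ^ h * real n ^ (h - 2))"
  proof (rule sum_bounded_above)
    fix e assume "e \<in> ?A"
    then show "codegree ?A ?w {e} \<le> real h ^ h * real n ^ (h - 2)"
      using codegrees_bounded_copy_weight[OF H G n h] unfolding codegrees_bounded_def
      by (elim allE[of _ "{e}"]) simp
  qed
  finally show ?thesis by simp
qed

lemma digraphs_on_iff:
  "G \<in> digraphs_on V \<longleftrightarrow> pverts G = V \<and> finite V \<and> parcs G \<subseteq> V \<times> V \<and> (\<forall>(u, v)\<in>parcs G. u \<noteq> v)"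
  by (auto simp: digraphs_on_def pair_digraph_iff)

text \<open>\<open>hypergraph_containers\<close> is applied to the copy hypergraph with
  \<open>K = h ^ h\<close>, \<open>\<kappa> = \<eta>\<close>,
  \<open>\<tau> = N powr (- 1 / m_density H)\<close> and \<open>D = N ^ (h - 2)\<close>. The bound
  on the number of containers depends on \<open>N\<close> but not on \<open>G\<close>, so it can be
  reused in every round.\<close>

lemma digraph_container_step:
  fixes H :: "'a pair_pre_digraph" and \<eta> :: real
  assumes H: "oriented_graph H" "card (parcs H) \<ge> 2" and \<eta>: "\<eta> > 0"
  shows "\<exists>q M. 0 \<le> q \<and> q < 1 \<and> 0 \<le> M \<and> (\<forall>N\<ge>1. \<forall>G\<in>digraphs_on {1..N::nat}.
    \<eta> * real N ^ card (pverts H) < real (card (embeddings H G)) \<longrightarrow>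
    (\<exists>\<F> \<subseteq> digraphs_on {1..N}. finite \<F> \<and>
      card \<F> \<le> (N\<^sup>2 + 1) ^ nat \<lfloor>M * (real N powr (2 - 1 / m_density H) + 1)\<rfloor> \<and>
      (\<forall>F\<in>\<F>. real (card (parcs F)) \<le> q * real (card (parcs G))) \<and>
      (\<forall>I\<in>digraphs_on {1..N}. H_free H I \<longrightarrow> parcs I \<subseteq> parcs G \<longrightarrow> (\<exists>F\<in>\<F>. parcs I \<subseteq> parcs F))))"
proof -
  note dH = oriented_graph_imp_pair_digraph[OF H(1)]
  define h where "h = card (pverts H)"
  define \<tau> where "\<tau> N = real N powr (- 1 / m_density H)" for N
  have h3: "h \<ge> 3" unfolding h_def by (rule card_verts_ge_3[OF H])
  then have h2: "2 \<le> h" by simp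
  have "real h ^ h > 0" using h3 by simp
  from hypergraph_containers[OF this \<eta>, of "card (parcs H)", where 'v = "nat \<times> nat"]
  obtain \<delta> M where \<delta>: "\<delta> > 0" and M: "M \<ge> 0" and cont:
    "\<And>(V :: (nat \<times> nat) set) w \<tau> D. finite V \<Longrightarrow> uniform_weight V (card (parcs H)) w \<Longrightarrow> \<tau> > 0 \<Longrightarrow> D > 0 \<Longrightarrow>
    codegrees_bounded V w (real h ^ h) \<tau> D \<Longrightarrow> \<eta> * real (card V) * D \<le> codegree V w {} \<Longrightarrow> V \<noteq> {} \<Longrightarrow>
    (\<exists>F s. real s \<le> M * (\<tau> * real (card V) + 1) \<and> card F \<le> (card V + 1) ^ s \<and> covers V \<delta> F (independent_for w))"
    by blast
  \<comment> \<open>The shrinking factor is cut off at 0 because \<open>\<delta>\<close> is only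
    known to be positive and could exceed 1.\<close>
  have "\<exists>\<F> \<subseteq> digraphs_on {1..N}. finite \<F> \<and>
      card \<F> \<le> (N\<^sup>2 + 1) ^ nat \<lfloor>M * (real N powr (2 - 1 / m_density H) + 1)\<rfloor> \<and>
      (\<forall>F\<in>\<F>. real (card (parcs F)) \<le> max 0 (1 - \<delta>) * real (card (parcs G))) \<and>
      (\<forall>I\<in>digraphs_on {1..N}. H_free H I \<longrightarrow> parcs I \<subseteq> parcs G \<longrightarrow> (\<exists>F\<in>\<F>. parcs I \<subseteq> parcs F))"
    if N: "N \<ge> 1" and G: "G \<in> digraphs_on {1..N}" and many: "\<eta> * real N ^ h < real (card (embeddings H G))"
    for N :: nat and G
  proof -
    let ?A = "parcs G" and ?w = "copy_weight H G"
    have dG: "pair_digraph G" and vG: "pverts G = {1..N}" using G by (auto simp: digraphs_on_def)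
    have cG: "N = card (pverts G)" by (simp add: vG)
    have cA: "card ?A \<le> N\<^sup>2" using card_parcs_le[OF dG] vG by simp
    have "0 \<le> \<eta> * real N ^ h" using \<eta> by simp
    then have "real (card (embeddings H G)) > 0" using many by linarith
    then have "embeddings H G \<noteq> {}" by auto
    moreover have "parcs H \<noteq> {}" using H(2) by auto
    ultimately have ne: "?A \<noteq> {}" by (auto simp: embeddings_def)
    \<comment> \<open>There are at most \<open>N * N\<close> arcs, so \<open>\<eta> * N ^ h\<close>
      embeddings give the density required by the container theorem.\<close>
    have "\<eta> * real (card ?A) * real N ^ (h - 2) \<le> \<eta> * real (N\<^sup>2) * real N ^ (h - 2)"
      using cA \<eta> by (intro mult_right_mono mult_left_mono of_nat_mono) auto
    also have "\<dots> = \<eta> * real N ^ h" 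
      using h2 by (simp only: of_nat_power mult.assoc power_add[symmetric] le_add_diff_inverse)
    also have "\<dots> \<le> codegree ?A ?w {}" using many by (simp add: codegree_copy_weight[OF dH dG])
    finally have dense: "\<eta> * real (card ?A) * real N ^ (h - 2) \<le> codegree ?A ?w {}" .
    have pos: "0 < \<tau> N" "0 < real N ^ (h - 2)" using N by (auto simp: \<tau>_def)
    note bounded = codegrees_bounded_copy_weight[OF H dG cG N h_def, folded \<tau>_def]
    obtain F s where F: "real s \<le> M * (\<tau> N * real (card ?A) + 1)" "card F \<le> (card ?A + 1) ^ s"
      "covers ?A \<delta> F (independent_for ?w)"
      using cont[OF finite_parcs[OF dG] uniform_copy_weight[OF dH dG] pos bounded dense ne] by blast
    have "\<tau> N * real (card ?A) \<le> \<tau> N * real (N\<^sup>2)"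
      using cA by (intro mult_left_mono of_nat_mono) (auto simp: \<tau>_def)
    also have "real (N\<^sup>2) = real N powr 2" by simp
    also have "\<tau> N * real N powr 2 = real N powr (2 - 1 / m_density H)"
      unfolding \<tau>_def powr_add[symmetric] by (rule arg_cong) simp
    finally have "M * (\<tau> N * real (card ?A) + 1) \<le> M * (real N powr (2 - 1 / m_density H) + 1)"
      using M by (intro mult_left_mono) auto
    then have s: "s \<le> nat \<lfloor>M * (real N powr (2 - 1 / m_density H) + 1)\<rfloor>" (is "_ \<le> ?S")
      using F(1) by (simp add: le_nat_iff le_floor_iff)
    define \<F> where "\<F> = (\<lambda>X. \<lparr>pverts = {1..N}, parcs = X\<rparr>) ` F"
    have finF: "finite F" using F(3) by (simp add: covers_def)
    have "card \<F> \<le> card F" unfolding \<F>_def using finF by (rule card_image_le)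
    also have "\<dots> \<le> (card ?A + 1) ^ s" by (rule F(2))
    also have "\<dots> \<le> (N\<^sup>2 + 1) ^ s" using cA by (intro power_mono) auto
    also have "\<dots> \<le> (N\<^sup>2 + 1) ^ ?S" using s by (intro power_increasing) auto
    finally have "card \<F> \<le> (N\<^sup>2 + 1) ^ ?S" .
    moreover have "\<F> \<subseteq> digraphs_on {1..N}"
      using F(3) G by (fastforce simp: \<F>_def covers_def digraphs_on_iff)
    moreover have "\<forall>D\<in>\<F>. real (card (parcs D)) \<le> max 0 (1 - \<delta>) * real (card ?A)"
    proof
      fix D assume "D \<in> \<F>"
      then have "real (card (parcs D)) \<le> (1 - \<delta>) * real (card ?A)"
        using F(3) by (auto simp: \<F>_def covers_def)
      also have "\<dots> \<le> max 0 (1 - \<delta>) * real (card ?A)" by (intro mult_right_mono) auto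
      finally show "real (card (parcs D)) \<le> max 0 (1 - \<delta>) * real (card ?A)" .
    qed
    moreover have "\<exists>D\<in>\<F>. parcs I \<subseteq> parcs D"
      if I: "I \<in> digraphs_on {1..N}" "H_free H I" "parcs I \<subseteq> ?A" for I
    proof -
      have dI: "pair_digraph I" "pverts I = pverts G" using I(1) vG by (auto simp: digraphs_on_def)
      \<comment> \<open>An embedding into \<open>G\<close> whose arcs all lie in \<open>I\<close>
        would embed \<open>H\<close> into \<open>I\<close>; so the arc set of an
        \<open>H\<close>-free digraph is independent.\<close>
      have "{\<phi> \<in> embeddings H G. map_prod \<phi> \<phi> ` parcs H = E} = {}" if "E \<subseteq> parcs I" for E
        using embeddings_subset_arcs[OF _ dI(2)] that I(2) H_free_iff[OF dH dI(1)] by blast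
      then have "independent_for ?w (parcs I)"
        unfolding independent_for_def copy_weight_def by (intro allI impI) (simp only: card.empty of_nat_0)
      then obtain X where "X \<in> F" "parcs I \<subseteq> X" using F(3) I(3) by (auto simp: covers_def)
      then show ?thesis by (auto simp: \<F>_def)
    qed
    moreover have "finite \<F>" using finF by (simp add: \<F>_def)
    ultimately show ?thesis by (intro exI[of _ \<F>] conjI ballI impI) blast+
  qed
  note main = this[unfolded h_def]
  show ?thesis
    by (intro exI[of _ "max 0 (1 - \<delta>)"] exI[of _ M] conjI allI ballI impI main) (use M \<delta> in simp_all)
qed

text \<open>In each round, digraphs with few embeddings are kept and every other one is replaced by
  its containers. After \<open>t\<close> rounds a digraph that still has too many embeddings has
  been shrunk \<open>t\<close> times by the factor \<open>q\<close>.\<close>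

lemma digraph_container_iteration:
  fixes H :: "'a pair_pre_digraph" and \<eta> q :: real and B N :: nat
  assumes q: "0 \<le> q" and B: "B \<ge> 1"
    and step: "\<And>G. G \<in> digraphs_on {1..N} \<Longrightarrow> \<eta> < real (card (embeddings H G)) \<Longrightarrow>
    \<exists>\<F> \<subseteq> digraphs_on {1..N}. finite \<F> \<and> card \<F> \<le> B \<and>
      (\<forall>F\<in>\<F>. real (card (parcs F)) \<le> q * real (card (parcs G))) \<and>
      (\<forall>I\<in>digraphs_on {1..N}. H_free H I \<longrightarrow> parcs I \<subseteq> parcs G \<longrightarrow> (\<exists>F\<in>\<F>. parcs I \<subseteq> parcs F))"
  shows "\<exists>\<C> \<subseteq> digraphs_on {1..N}. finite \<C> \<and> card \<C> \<le> B ^ t \<and>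
    (\<forall>G\<in>\<C>. real (card (embeddings H G)) \<le> \<eta> \<or> real (card (parcs G)) \<le> q ^ t * (real N)\<^sup>2) \<and>
    (\<forall>I\<in>digraphs_on {1..N}. H_free H I \<longrightarrow> (\<exists>G\<in>\<C>. parcs I \<subseteq> parcs G))"
proof (induction t)
  case 0
  \<comment> \<open>The complete digraph, with both arcs between any two vertices, contains every
    digraph on \<open>{1..N}\<close>.\<close>
  let ?G = "\<lparr>pverts = {1..N}, parcs = {(u, v). u \<in> {1..N} \<and> v \<in> {1..N} \<and> u \<noteq> v}\<rparr>"
  have G: "?G \<in> digraphs_on {1..N}" by (auto simp: digraphs_on_iff)
  then have "card (parcs ?G) \<le> N\<^sup>2" using card_parcs_le[of ?G] by (simp add: digraphs_on_def)
  then have "real (card (parcs ?G)) \<le> real (N\<^sup>2)" by (rule of_nat_mono)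
  moreover have "\<forall>I\<in>digraphs_on {1..N}. parcs I \<subseteq> parcs ?G" by (fastforce simp: digraphs_on_iff)
  ultimately show ?case using G by (intro exI[of _ "{?G}"]) auto
next
  case (Suc t)
  then obtain \<C> where \<C>: "\<C> \<subseteq> digraphs_on {1..N}" "finite \<C>" "card \<C> \<le> B ^ t"
    "\<And>G. G \<in> \<C> \<Longrightarrow> real (card (embeddings H G)) \<le> \<eta> \<or> real (card (parcs G)) \<le> q ^ t * (real N)\<^sup>2"
    "\<And>I. I \<in> digraphs_on {1..N} \<Longrightarrow> H_free H I \<Longrightarrow> \<exists>G\<in>\<C>. parcs I \<subseteq> parcs G"
    by blast
  have "\<forall>G\<in>\<C>. \<exists>\<F>. \<F> \<subseteq> digraphs_on {1..N} \<and> finite \<F> \<and> card \<F> \<le> B \<and>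
    (\<forall>F\<in>\<F>. real (card (embeddings H F)) \<le> \<eta> \<or> real (card (parcs F)) \<le> q ^ Suc t * (real N)\<^sup>2) \<and>
    (\<forall>I\<in>digraphs_on {1..N}. H_free H I \<longrightarrow> parcs I \<subseteq> parcs G \<longrightarrow> (\<exists>F\<in>\<F>. parcs I \<subseteq> parcs F))" (is "\<forall>G\<in>\<C>. \<exists>\<F>. ?P G \<F>")
  proof
    fix G assume G: "G \<in> \<C>"
    show "\<exists>\<F>. \<F> \<subseteq> digraphs_on {1..N} \<and> finite \<F> \<and> card \<F> \<le> B \<and>
      (\<forall>F\<in>\<F>. real (card (embeddings H F)) \<le> \<eta> \<or> real (card (parcs F)) \<le> q ^ Suc t * (real N)\<^sup>2) \<and>
      (\<forall>I\<in>digraphs_on {1..N}. H_free H I \<longrightarrow> parcs I \<subseteq> parcs G \<longrightarrow> (\<exists>F\<in>\<F>. parcs I \<subseteq> parcs F))"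
    proof (cases "real (card (embeddings H G)) \<le> \<eta>")
      case True
      then show ?thesis using G \<C>(1) B by (intro exI[of _ "{G}"]) auto
    next
      case False
      then have small: "real (card (parcs G)) \<le> q ^ t * (real N)\<^sup>2" using \<C>(4)[OF G] by simp
      have "\<eta> < real (card (embeddings H G))" using False by simp
      from step[OF subsetD[OF \<C>(1) G] this] obtain \<F> where \<F>: "\<F> \<subseteq> digraphs_on {1..N}" "finite \<F>" "card \<F> \<le> B"
        "\<And>F. F \<in> \<F> \<Longrightarrow> real (card (parcs F)) \<le> q * real (card (parcs G))"
        "\<forall>I\<in>digraphs_on {1..N}. H_free H I \<longrightarrow> parcs I \<subseteq> parcs G \<longrightarrow> (\<exists>F\<in>\<F>. parcs I \<subseteq> parcs F)"
        by blast
      have "real (card (parcs F)) \<le> q ^ Suc t * (real N)\<^sup>2" if "F \<in> \<F>" for F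
        using order_trans[OF \<F>(4)[OF that] mult_left_mono[OF small q]] by (simp add: mult.assoc)
      then show ?thesis using \<F> by blast
    qed
  qed
  from bchoice[OF this] obtain \<F> where "\<forall>G\<in>\<C>. ?P G (\<F> G)" ..
  then have P: "?P G (\<F> G)" if "G \<in> \<C>" for G using that by (rule bspec)
  note \<F> = P[THEN conjunct1] P[THEN conjunct2, THEN conjunct1]
    P[THEN conjunct2, THEN conjunct2, THEN conjunct1]
    P[THEN conjunct2, THEN conjunct2, THEN conjunct2, THEN conjunct1, rule_format]
    P[THEN conjunct2, THEN conjunct2, THEN conjunct2, THEN conjunct2, rule_format]
  have "card (\<Union>G\<in>\<C>. \<F> G) \<le> (\<Sum>G\<in>\<C>. card (\<F> G))" by (rule card_UN_le[OF \<C>(2)])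
  also have "\<dots> \<le> of_nat (card \<C>) * B" using \<F>(3) by (rule sum_bounded_above)
  also have "\<dots> \<le> B ^ Suc t" using \<C>(3) by (simp add: mult.commute)
  finally have "card (\<Union>G\<in>\<C>. \<F> G) \<le> B ^ Suc t" .
  moreover have "(\<Union>G\<in>\<C>. \<F> G) \<subseteq> digraphs_on {1..N}" "finite (\<Union>G\<in>\<C>. \<F> G)" using \<F>(1,2) \<C>(2) by auto
  moreover have "\<forall>F\<in>(\<Union>G\<in>\<C>. \<F> G). real (card (embeddings H F)) \<le> \<eta> \<or> real (card (parcs F)) \<le> q ^ Suc t * (real N)\<^sup>2"
    using \<F>(4) by blast
  moreover have "\<forall>I\<in>digraphs_on {1..N}. H_free H I \<longrightarrow> (\<exists>G\<in>(\<Union>G\<in>\<C>. \<F> G). parcs I \<subseteq> parcs G)"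
  proof (intro ballI impI)
    fix I assume I: "I \<in> digraphs_on {1..N}" "H_free H I"
    obtain G where G: "G \<in> \<C>" "parcs I \<subseteq> parcs G" using \<C>(5)[OF I] ..
    obtain F where "F \<in> \<F> G" "parcs I \<subseteq> parcs F" using \<F>(5)[OF G(1) I G(2)] ..
    then show "\<exists>G\<in>(\<Union>G\<in>\<C>. \<F> G). parcs I \<subseteq> parcs G" using G(1) by blast
  qed
  ultimately show ?case by blast
qed

text \<open>After a number of rounds independent of \<open>N\<close>, the second alternative of the
  iteration also forces few embeddings, by \<open>card_embeddings_le_arcs\<close>. The base
  \<open>N * N + 1\<close> of the counting bound produces the factor \<open>log 2 N\<close>.\<close>

lemma digraph_containers:
  fixes H :: "'a pair_pre_digraph" and \<eta> :: real
  assumes H: "oriented_graph H" "card (parcs H) \<ge> 2" and \<eta>: "\<eta> > 0"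
  shows "\<exists>c>0. \<forall>N\<ge>2. \<exists>\<C> \<subseteq> digraphs_on {1..N::nat}.
    (\<forall>I \<in> digraphs_on {1..N}. H_free H I \<longrightarrow> (\<exists>G\<in>\<C>. parcs I \<subseteq> parcs G)) \<and>
    (\<forall>G\<in>\<C>. real (card (embeddings H G)) \<le> \<eta> * real N ^ card (pverts H)) \<and>
    log 2 (real (card \<C>)) \<le> c * real N powr (2 - 1 / m_density H) * log 2 (real N)"
proof -
  define h where "h = card (pverts H)"
  have h3: "h \<ge> 3" unfolding h_def by (rule card_verts_ge_3[OF H])
  then have h2: "2 \<le> h" by simp
  let ?x = "\<lambda>N::nat. real N powr (2 - 1 / m_density H)"
  let ?S = "\<lambda>M N. nat \<lfloor>M * (?x N + 1)\<rfloor>"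
  from digraph_container_step[OF H \<eta>, folded h_def] show ?thesis
  proof (elim exE conjE)
    fix q M :: real assume q: "0 \<le> q" "q < 1" and M: "0 \<le> M"
      and step: "\<forall>N\<ge>1. \<forall>G\<in>digraphs_on {1..N::nat}.
      \<eta> * real N ^ h < real (card (embeddings H G)) \<longrightarrow>
      (\<exists>\<F> \<subseteq> digraphs_on {1..N}. finite \<F> \<and> card \<F> \<le> (N\<^sup>2 + 1) ^ ?S M N \<and>
        (\<forall>F\<in>\<F>. real (card (parcs F)) \<le> q * real (card (parcs G))) \<and>
        (\<forall>I\<in>digraphs_on {1..N}. H_free H I \<longrightarrow> parcs I \<subseteq> parcs G \<longrightarrow> (\<exists>F\<in>\<F>. parcs I \<subseteq> parcs F)))"
    have hh: "real h ^ h > 0" using h3 by simp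
    obtain t where "q ^ t < \<eta> / real h ^ h" using real_arch_pow_inv[of "\<eta> / real h ^ h" q] hh \<eta> q by auto
    then have t: "q ^ t * real h ^ h \<le> \<eta>" using hh by (simp add: pos_less_divide_eq)
    \<comment> \<open>The 6 is 2 times 3: \<open>?x N + 1 \<le> 2 * ?x N\<close>, and the base of
      the counting bound is at most \<open>N ^ 3\<close>. The summand 1 keeps \<open>c\<close>
      positive if \<open>t\<close> or \<open>M\<close> is 0.\<close>
    define c where "c = real t * M * 6 + 1"
    have c: "c > 0" using M by (simp add: c_def add_nonneg_pos)
    have "\<exists>\<C> \<subseteq> digraphs_on {1..N::nat}.
      (\<forall>I \<in> digraphs_on {1..N}. H_free H I \<longrightarrow> (\<exists>G\<in>\<C>. parcs I \<subseteq> parcs G)) \<and>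
      (\<forall>G\<in>\<C>. real (card (embeddings H G)) \<le> \<eta> * real N ^ h) \<and>
      log 2 (real (card \<C>)) \<le> c * ?x N * log 2 (real N)" if N: "N \<ge> 2" for N
    proof -
      have N1: "N \<ge> 1" using N by simp
      have "\<exists>\<C> \<subseteq> digraphs_on {1..N}. finite \<C> \<and> card \<C> \<le> ((N\<^sup>2 + 1) ^ ?S M N) ^ t \<and>
        (\<forall>G\<in>\<C>. real (card (embeddings H G)) \<le> \<eta> * real N ^ h \<or> real (card (parcs G)) \<le> q ^ t * (real N)\<^sup>2) \<and>
        (\<forall>I\<in>digraphs_on {1..N}. H_free H I \<longrightarrow> (\<exists>G\<in>\<C>. parcs I \<subseteq> parcs G))"
        by (rule digraph_container_iteration[OF q(1) _ step[rule_format, OF N1]]) simp_all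
      then obtain \<C> where \<C>: "\<C> \<subseteq> digraphs_on {1..N}" "finite \<C>" "card \<C> \<le> ((N\<^sup>2 + 1) ^ ?S M N) ^ t"
        "\<And>G. G \<in> \<C> \<Longrightarrow> real (card (embeddings H G)) \<le> \<eta> * real N ^ h \<or> real (card (parcs G)) \<le> q ^ t * (real N)\<^sup>2"
        "\<forall>I\<in>digraphs_on {1..N}. H_free H I \<longrightarrow> (\<exists>G\<in>\<C>. parcs I \<subseteq> parcs G)"
        by auto
      have few: "real (card (embeddings H G)) \<le> \<eta> * real N ^ h" if G: "G \<in> \<C>" for G
      proof (cases "real (card (parcs G)) \<le> q ^ t * (real N)\<^sup>2")
        case True
        have dG: "pair_digraph G" "N = card (pverts G)" using G \<C>(1) by (auto simp: digraphs_on_def)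
        have "real (card (embeddings H G)) \<le> real (card (parcs G)) * (real h ^ h * real N ^ (h - 2))"
          by (rule card_embeddings_le_arcs[OF H dG N1 h_def])
        also have "\<dots> \<le> (q ^ t * (real N)\<^sup>2) * (real h ^ h * real N ^ (h - 2))"
          using True by (intro mult_right_mono) auto
        also have "\<dots> = (q ^ t * real h ^ h) * ((real N)\<^sup>2 * real N ^ (h - 2))" by simp
        also have "(real N)\<^sup>2 * real N ^ (h - 2) = real N ^ h" 
          using h2 by (simp only: power_add[symmetric] le_add_diff_inverse)
        also have "(q ^ t * real h ^ h) * real N ^ h \<le> \<eta> * real N ^ h" using t by (intro mult_right_mono) auto
        finally show ?thesis .
      qed (use \<C>(4)[OF G] in simp)
      have L: "log 2 (real N) \<ge> 0" using N by simp
      have x1: "?x N \<ge> 1"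
      proof (rule ge_one_powr_ge_zero)
        show "0 \<le> 2 - 1 / m_density H" using m_density_ge_half[OF H] by (simp add: pos_divide_le_eq)
      qed (use N in simp)
      have "log 2 (real (card \<C>)) \<le> real t * (real (?S M N) * log 2 (real (N\<^sup>2 + 1)))"
      proof (cases "card \<C> = 0")
        \<comment> \<open>For an empty family the left side is the default value
          \<open>log 2 0 = 0\<close>.\<close>
        case True
        then show ?thesis by (simp add: log_def)
      next
        case False
        have "real (card \<C>) \<le> real (((N\<^sup>2 + 1) ^ ?S M N) ^ t)" using \<C>(3) by (rule of_nat_mono)
        then have "log 2 (real (card \<C>)) \<le> log 2 (real (((N\<^sup>2 + 1) ^ ?S M N) ^ t))"
          using False by (intro log_mono) auto
        also have "\<dots> = real t * (real (?S M N) * log 2 (real (N\<^sup>2 + 1)))"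
          unfolding of_nat_power by (subst log_nat_power, simp)+ simp
        finally show ?thesis .
      qed
      also have "\<dots> \<le> real t * ((M * (2 * ?x N)) * (3 * log 2 (real N)))"
      proof (intro mult_left_mono mult_mono)
        have "real (?S M N) \<le> M * (?x N + 1)" using M by simp
        also have "\<dots> \<le> M * (2 * ?x N)" using M x1 by (intro mult_left_mono) auto
        finally show "real (?S M N) \<le> M * (2 * ?x N)" .
        have "N\<^sup>2 + 1 \<le> N\<^sup>2 * 2" using N by simp
        also have "\<dots> \<le> N\<^sup>2 * N" using N by (intro mult_left_mono) auto
        also have "\<dots> = N ^ 3" by (simp add: power2_eq_square power3_eq_cube)
        finally have "real (N\<^sup>2 + 1) \<le> real (N ^ 3)" by (rule of_nat_mono)
        then have "log 2 (real (N\<^sup>2 + 1)) \<le> log 2 (real (N ^ 3))"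
          by (intro log_mono) (auto simp: add_pos_nonneg)
        also have "\<dots> = 3 * log 2 (real N)" using N by (simp add: log_nat_power)
        finally show "log 2 (real (N\<^sup>2 + 1)) \<le> 3 * log 2 (real N)" .
        show "0 \<le> log 2 (real (N\<^sup>2 + 1))" by (rule zero_le_log_cancel_iff[THEN iffD2]) (auto simp: add_pos_nonneg)
      qed (use M x1 in auto)
      also have "\<dots> = (real t * M * 6) * (?x N * log 2 (real N))" by simp
      also have "\<dots> \<le> c * (?x N * log 2 (real N))" using L by (intro mult_right_mono) (auto simp: c_def)
      finally have "log 2 (real (card \<C>)) \<le> c * ?x N * log 2 (real N)" by (simp add: mult.assoc)
      then show ?thesis using \<C>(1,5) few by blast
    qed
    then show ?thesis using c unfolding h_def by blast
  qed
qed

theorem theorem3p3: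
  fixes H :: "'a pair_pre_digraph" and a \<epsilon> :: real
  assumes "oriented_graph H"
    and "card (parcs H) \<ge> 2"
    and "a \<ge> 1"
    and "\<epsilon> > 0"
  shows "\<exists>c::real. c > 0 \<and> (\<exists>N\<^sub>0::nat. \<forall>N\<ge>N\<^sub>0. \<exists>\<C> \<subseteq> digraphs_on {1..N}.
    (\<forall>I \<in> digraphs_on {1..N}. H_free H I \<longrightarrow> (\<exists>G\<in>\<C>. parcs I \<subseteq> parcs G)) \<and>
    (\<forall>G\<in>\<C>. real (card (copies H G)) \<le> \<epsilon> * real N ^ card (pverts H) \<and>
      weighted_size a G \<le> ex_weighted a N H + \<epsilon> * (real N)\<^sup>2) \<and>
    log 2 (real (card \<C>)) \<le> c * real N powr (2 - 1 / m_density H) * log 2 (real N))"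
proof -
  note dH = oriented_graph_imp_pair_digraph[OF assms(1)]
  have "parcs H \<noteq> {}" using assms(2) by auto
  from supersaturation[OF dH this assms(3,4)] obtain \<eta>\<^sub>0 N\<^sub>0 where \<eta>\<^sub>0: "\<eta>\<^sub>0 > 0" and
    sup: "\<And>G :: nat pair_pre_digraph. pair_digraph G \<Longrightarrow> card (pverts G) \<ge> N\<^sub>0 \<Longrightarrow>
    real (card (embeddings H G)) \<le> \<eta>\<^sub>0 * real (card (pverts G)) ^ card (pverts H) \<Longrightarrow>
    weighted_size a G \<le> ex_weighted a (card (pverts G)) H + \<epsilon> * (real (card (pverts G)))\<^sup>2"
    by blast
  \<comment> \<open>One bound on the number of embeddings serves both purposes:
    \<open>\<eta>\<^sub>0\<close> controls the weighted size by supersaturation, and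
    \<open>\<epsilon>\<close> controls the copies, of which there are no more than
    embeddings.\<close>
  have "min \<eta>\<^sub>0 \<epsilon> > 0" using \<eta>\<^sub>0 assms(4) by simp
  from digraph_containers[OF assms(1,2) this] obtain c where c: "c > 0" and cont:
    "\<And>N. N \<ge> 2 \<Longrightarrow> \<exists>\<C> \<subseteq> digraphs_on {1..N::nat}.
    (\<forall>I \<in> digraphs_on {1..N}. H_free H I \<longrightarrow> (\<exists>G\<in>\<C>. parcs I \<subseteq> parcs G)) \<and>
    (\<forall>G\<in>\<C>. real (card (embeddings H G)) \<le> min \<eta>\<^sub>0 \<epsilon> * real N ^ card (pverts H)) \<and>
    log 2 (real (card \<C>)) \<le> c * real N powr (2 - 1 / m_density H) * log 2 (real N)"
    by blast
  have good: "real (card (copies H G)) \<le> \<epsilon> * real N ^ card (pverts H) \<and>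
      weighted_size a G \<le> ex_weighted a N H + \<epsilon> * (real N)\<^sup>2"
    if N: "N \<ge> N\<^sub>0" and G: "G \<in> digraphs_on {1..N}"
      and emb: "real (card (embeddings H G)) \<le> min \<eta>\<^sub>0 \<epsilon> * real N ^ card (pverts H)" for N G
  proof
    have dG: "pair_digraph G" "card (pverts G) = N" using G by (auto simp: digraphs_on_def)
    have "real (card (copies H G)) \<le> real (card (embeddings H G))"
      using card_copies_le[OF dH dG(1)] by simp
    also have "\<dots> \<le> min \<eta>\<^sub>0 \<epsilon> * real N ^ card (pverts H)" by (rule emb)
    also have "\<dots> \<le> \<epsilon> * real N ^ card (pverts H)" by (intro mult_right_mono) auto
    finally show "real (card (copies H G)) \<le> \<epsilon> * real N ^ card (pverts H)" .
    have "min \<eta>\<^sub>0 \<epsilon> * real N ^ card (pverts H) \<le> \<eta>\<^sub>0 * real N ^ card (pverts H)"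
      by (intro mult_right_mono) auto
    then show "weighted_size a G \<le> ex_weighted a N H + \<epsilon> * (real N)\<^sup>2"
      using sup[OF dG(1)] dG(2) N emb by simp
  qed
  show ?thesis
  \<comment> \<open>The container family is available from \<open>N = 2\<close> on, the bound on the
    weighted size from \<open>N\<^sub>0\<close> on.\<close>
  proof (intro exI[of _ c] conjI c exI[of _ "max 2 N\<^sub>0"] allI impI)
    fix N assume N: "max 2 N\<^sub>0 \<le> N"
    then obtain \<C> where \<C>: "\<C> \<subseteq> digraphs_on {1..N}"
      "\<forall>I \<in> digraphs_on {1..N}. H_free H I \<longrightarrow> (\<exists>G\<in>\<C>. parcs I \<subseteq> parcs G)"
      "\<And>G. G \<in> \<C> \<Longrightarrow> real (card (embeddings H G)) \<le> min \<eta>\<^sub>0 \<epsilon> * real N ^ card (pverts H)"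
      "log 2 (real (card \<C>)) \<le> c * real N powr (2 - 1 / m_density H) * log 2 (real N)"
      using cont[of N] by auto
    then show "\<exists>\<C> \<subseteq> digraphs_on {1..N}.
      (\<forall>I \<in> digraphs_on {1..N}. H_free H I \<longrightarrow> (\<exists>G\<in>\<C>. parcs I \<subseteq> parcs G)) \<and>
      (\<forall>G\<in>\<C>. real (card (copies H G)) \<le> \<epsilon> * real N ^ card (pverts H) \<and>
        weighted_size a G \<le> ex_weighted a N H + \<epsilon> * (real N)\<^sup>2) \<and>
      log 2 (real (card \<C>)) \<le> c * real N powr (2 - 1 / m_density H) * log 2 (real N)"
      using N good by (intro exI[of _ \<C>]) auto
  qed
qed

end
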